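(* Let $U,V\in\mathcal{U}$, and let $\mathbb{P}$ and $\mathbb{Q}$ be the unique Gibbs measures on $\Omega=\mathcal{A}^{\mathbb{Z}}$ with interactions $U$ and $V$, respectively. Let $$\tilde\alpha=\tfrac12p(U)+\tfrac12p(V)-\tfrac12p(U+V)$$ (which is strictly positive) and $\tilde k^*(n)=\frac{\log n}{\tilde\alpha}$. Let $\sigma,\eta$ be independent with distributions $\mathbb{P}$ and $\mathbb{Q}$, respectively, let $N(\sigma,\eta,n,k)$ be the number of matches with shift of length $k$, and let $\mathbb{E}_{\mathbb{P}\otimes\mathbb{Q}}$ denote expectation with respect to the product measure $\mathbb{P}\otimes\mathbb{Q}$. Let $\{k(n)\}_{n\in\mathbb{N}}$ be a sequence of integers. Then: 1. If $\tilde k^*(n)-k(n)\to\infty$ as $n\to\infty$, then $\lim_{n\to\infty}\mathbb{E}_{\mathbb{P}\otimes\mathbb{Q}}(N(\sigma,\eta,n,k(n)))=\infty$. 2. If $k(n)-\tilde k^*(n)\to\infty$ as $n\to\infty$, then $\lim_{n\to\infty}\mathbb{E}_{\mathbb{P}\otimes\mathbb{Q}}(N(\sigma,\eta,n,k(n)))=0$. 3. If $k(n)-\tilde k^*(n)$ is a bounded sequence, then $$0<\liminf_{n\to\infty}\mathbb{E}_{\mathbb{P}\otimes\mathbb{Q}}(N(\sigma,\eta,n,k(n)))\le\limsup_{n\to\infty}\mathbb{E}_{\mathbb{P}\otimes\mathbb{Q}}(N(\sigma,\eta,n,k(n)))<\infty.$$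
   Context: $\mathcal{A}$ is a finite set with at least two elements; $\Omega=\mathcal{A}^{\mathbb{Z}}$ with the product topology and product sigma-field; $\mathcal{S}$ is the set of (nonempty) finite subsets of $\mathbb{Z}$; for $W\subseteq\mathbb{Z}$, $\sigma_W$ is the restriction of $\sigma\in\Omega$ to $W$, $\Omega_W=\mathcal{A}^W$, and $\mathcal{F}_W$ is the sigma-field generated by $\{\sigma(i):i\in W\}$. The shift is $(\tau_i\sigma)(j)=\sigma(i+j)$. $\operatorname{diam}(A)=\max\{|i-j|:i,j\in A\}$. $C_k=\{1,\dots,k\}$. Interactions: $\mathcal{U}$ is the set of maps $U:\mathcal{S}\times\Omega\to\mathbb{R}$ such that (i) $\sigma\mapsto U(A,\sigma)$ is $\mathcal{F}_A$-measurable for all $A\in\mathcal{S}$; (ii) $U(A+i,\tau_{-i}\sigma)=U(A,\sigma)$ for all $A\in\mathcal{S}$, $i\in\mathbb{Z}$, $\sigma\in\Omega$; (iii) there is $\gamma>0$ with $\sum_{A\ni 0}e^{\gamma\operatorname{diam}(A)}\sup_{\sigma\in\Omega}|U(A,\sigma)|<\infty$. $U+V$ is the pointwise sum of interactions. Gibbs measures: for $\Lambda\in\mathcal{S}$, $\zeta\in\Omega$, put $H_\Lambda^\zeta(\sigma)=\sum_{A\cap\Lambda\ne\varnothing}U(A,\sigma_\Lambda\zeta_{\Lambda^c})$, where $\sigma_\Lambda\zeta_{\Lambda^c}$ equals $\sigma$ on $\Lambda$ and $\zeta$ off $\Lambda$. A probability measure $\mathbb{P}$ on $\Omega$ is a Gibbs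 measure with interaction $U$ if for all $\Lambda\in\mathcal{S}$ the conditional distribution of $\sigma_\Lambda$ given $\sigma_{\Lambda^c}=\zeta_{\Lambda^c}$ is, for $\mathbb{P}$-a.e. $\zeta$, given by the weights $e^{-H_\Lambda^\zeta(\sigma)}/\sum_{\sigma'_\Lambda\in\Omega_\Lambda}e^{-H_\Lambda^\zeta(\sigma')}$. For $U\in\mathcal{U}$ there is exactly one Gibbs measure with interaction $U$. Pressure: $p(U)=\lim_{n\to\infty}\frac1n\log\sum_{\sigma_{C_n}\in\Omega_{C_n}}\exp\bigl(-\sum_{A\subseteq C_n}U(A,\sigma)\bigr)$. Number of shift-matches for two strings: for $\sigma,\eta\in\Omega$ and integers $1\le k<n$, $N(\sigma,\eta,n,k)=\sum_{i=0}^{n-k}\sum_{j=0,\,j\ne i}^{n-k}\mathbb{1}\{(\tau_i\sigma)_{C_k}=(\tau_j\eta)_{C_k}\}$. Sequences $k(n)$ are understood to satisfy $1\le k(n)<n$ for all sufficiently large $n$, so that $N(\sigma,\eta,n,k(n))$ is defined. *)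

theory Defs
  imports "HOL-Probability.Probability"
begin

text \<open>The alphabet is a type of class \<open>finite\<close>; a configuration is a two-sided
  sequence over it.  A local configuration on \<open>W\<close> is an extensional function on \<open>W\<close>.\<close>

type_synonym 'a config = "int \<Rightarrow> 'a"

type_synonym 'a interaction = "int set \<Rightarrow> 'a config \<Rightarrow> real"

definition config_space :: "'a::finite config measure" where
  "config_space = (\<Pi>\<^sub>M i\<in>UNIV. count_space UNIV)"

definition local_configs :: "int set \<Rightarrow> 'a::finite config set" where
  "local_configs W = (\<Pi>\<^sub>E i\<in>W. UNIV)"

definition coord_algebra :: "int set \<Rightarrow> 'a::finite config measure" where
  "coord_algebra W = sigma UNIV {(\<lambda>\<sigma>. \<sigma> i) -` B | i B. i \<in> W}"

definition shift :: "int \<Rightarrow> 'a config \<Rightarrow> 'a config" where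
  "shift i \<sigma> = (\<lambda>j. \<sigma> (i + j))"

definition finite_regions :: "int set set" where
  "finite_regions = {A. finite A \<and> A \<noteq> {}}"

definition diam :: "int set \<Rightarrow> int" where
  "diam A = Max {\<bar>i - j\<bar> | i j. i \<in> A \<and> j \<in> A}"

definition initial_interval :: "int \<Rightarrow> int set" where
  "initial_interval k = {1..k}"

text \<open>Interactions only matter on \<^const>\<open>finite_regions\<close>; their values at other sets are
  unconstrained and never used.  The real supremum is over a bounded set, because a function
  measurable with respect to \<open>coord_algebra A\<close> with \<open>A\<close> finite takes finitely many values.\<close>

definition interactions :: "'a::finite interaction set" where
  "interactions = {U.
     (\<forall>A\<in>finite_regions. U A \<in> borel_measurable (coord_algebra A)) \<and>
     (\<forall>A\<in>finite_regions. \<forall>i \<sigma>. U ((\<lambda>x. x + i) ` A) (shift (- i) \<sigma>) = U A \<sigma>) \<and>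
     (\<exists>\<gamma>>0. (\<lambda>A. exp (\<gamma> * real_of_int (diam A)) * (SUP \<sigma>. \<bar>U A \<sigma>\<bar>))
        summable_on {A \<in> finite_regions. 0 \<in> A})}"

text \<open>\<open>override_on \<zeta> \<sigma> \<Lambda>\<close> equals \<open>\<sigma>\<close> on \<open>\<Lambda>\<close> and \<open>\<zeta>\<close> off \<open>\<Lambda>\<close>.  For an interaction in
  \<open>interactions\<close> the sum converges absolutely.\<close>

definition hamiltonian ::
    "'a::finite interaction \<Rightarrow> int set \<Rightarrow> 'a config \<Rightarrow> 'a config \<Rightarrow> real" where
  "hamiltonian U \<Lambda> \<zeta> \<sigma> =
     (\<Sum>\<^sub>\<infinity>A\<in>{A \<in> finite_regions. A \<inter> \<Lambda> \<noteq> {}}. U A (override_on \<zeta> \<sigma> \<Lambda>))"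

text \<open>The conditional distribution of the restriction to \<open>\<Lambda>\<close> given the configuration off \<open>\<Lambda>\<close>
  is expressed by the conditional probabilities, given \<open>coord_algebra (- \<Lambda>)\<close>, of the
  finitely many values of that restriction.\<close>

definition gibbs_measure :: "'a::finite interaction \<Rightarrow> 'a config measure \<Rightarrow> bool" where
  "gibbs_measure U P \<longleftrightarrow>
     prob_space P \<and> sets P = sets config_space \<and>
     (\<forall>\<Lambda>\<in>finite_regions. AE \<zeta> in P. \<forall>\<xi>\<in>local_configs \<Lambda>.
        real_cond_exp P (coord_algebra (- \<Lambda>)) (indicator {\<sigma>. restrict \<sigma> \<Lambda> = \<xi>}) \<zeta> =
        exp (- hamiltonian U \<Lambda> \<zeta> \<xi>) /
          (\<Sum>\<xi>'\<in>local_configs \<Lambda>. exp (- hamiltonian U \<Lambda> \<zeta> \<xi>')))"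

lemma coord_algebra_subalgebra:
  assumes "sets P = sets (config_space :: 'a::finite config measure)"
  shows "subalgebra P (coord_algebra W)"
proof -
  have sp: "space P = UNIV"
    using sets_eq_imp_space_eq[OF assms] by (simp add: config_space_def space_PiM)
  have gen: "(\<lambda>\<sigma>::'a config. \<sigma> i) -` B \<in> sets P" for i B
    using measurable_sets[of "\<lambda>\<sigma>::'a config. \<sigma> i" config_space "count_space UNIV" B]
    by (simp add: assms config_space_def space_PiM)
  let ?G = "{(\<lambda>\<sigma>::'a config. \<sigma> i) -` B | i B. i \<in> W}"
  have "sigma_sets (space P) ?G \<subseteq> sets P"
    using gen by (intro sets.sigma_sets_subset) auto
  moreover have "space (coord_algebra W) = (UNIV :: 'a config set)"
      "sets (coord_algebra W) = sigma_sets UNIV ?G"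
    unfolding coord_algebra_def by (simp_all add: space_measure_of_conv sets_measure_of_conv)
  ultimately show ?thesis
    unfolding subalgebra_def sp by simp
qed

text \<open>Since \<open>U A\<close> only depends on the coordinates in \<open>A\<close>, evaluating it at an
  extensional function on \<open>C\<^sub>n\<close> involves no choice when \<open>A \<subseteq> C\<^sub>n\<close>.\<close>

definition pressure :: "'a::finite interaction \<Rightarrow> real" where
  "pressure U = lim (\<lambda>n::nat. 1 / real n * ln (\<Sum>\<sigma>\<in>local_configs (initial_interval (int n)).
     exp (- (\<Sum>A\<in>{A \<in> finite_regions. A \<subseteq> initial_interval (int n)}. U A \<sigma>))))"

definition num_shift_matches :: "'a config \<Rightarrow> 'a config \<Rightarrow> int \<Rightarrow> int \<Rightarrow> nat" where
  "num_shift_matches \<sigma> \<eta> n k =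
     (\<Sum>i\<in>{0..n - k}. \<Sum>j\<in>{0..n - k} - {i}.
        of_bool (restrict (shift i \<sigma>) (initial_interval k) =
                 restrict (shift j \<eta>) (initial_interval k)))"

definition expected_matches ::
    "'a config measure \<Rightarrow> 'a config measure \<Rightarrow> int \<Rightarrow> int \<Rightarrow> real" where
  "expected_matches P Q n k =
     (\<integral>(\<sigma>, \<eta>). real (num_shift_matches \<sigma> \<eta> n k) \<partial>(P \<Otimes>\<^sub>M Q))"

definition alpha_tilde :: "'a::finite interaction \<Rightarrow> 'a interaction \<Rightarrow> real" where
  "alpha_tilde U V =
     1/2 * pressure U + 1/2 * pressure V - 1/2 * pressure (\<lambda>A \<sigma>. U A \<sigma> + V A \<sigma>)"

definition k_star_tilde :: "'a::finite interaction \<Rightarrow> 'a interaction \<Rightarrow> nat \<Rightarrow> real" where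
  "k_star_tilde U V n = ln (real n) / alpha_tilde U V"

end

theory Submission
  imports Defs
begin

text \<open>The interaction across a boundary point of an interval is bounded, because the summability
  condition controls \<open>\<Sum> diam A \<parallel>U A\<parallel>\<close> over the regions \<open>A\<close> containing the origin.  Hence, by the
  conditional probabilities defining a Gibbs measure, every cylinder over an interval of length \<open>k\<close>
  has probability \<open>exp (- energy) / Z\<^sub>k(U)\<close> up to a constant factor, wherever the interval lies.
  For the same reason \<open>ln Z\<^sub>k\<close>
  is additive up to a constant and thus equals \<open>k p(U)\<close> up to a constant.  Summing over cylinders,
  the expected number of matches is comparable to
  \<open>(n - k + 1) (n - k) Z\<^sub>k(U + V) / (Z\<^sub>k(U) Z\<^sub>k(V))\<close>, that is, to \<open>(n - k)\<^sup>2 exp (- 2 \<alpha> k)\<close>.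
  Positivity of \<open>\<alpha>\<close> holds because no single configuration carries more than an exponentially small
  share of \<open>Z\<^sub>k(U)\<close>.\<close>

subsection \<open>Interactions and boundary energies\<close>

lemma abs_diff_le_diam:
  assumes "finite A" "x \<in> A" "y \<in> A"
  shows "\<bar>x - y\<bar> \<le> diam A"
proof -
  have "{\<bar>i - j\<bar> |i j. i \<in> A \<and> j \<in> A} = (\<lambda>(i, j). \<bar>i - j\<bar>) ` (A \<times> A)"
    by auto
  then have "finite {\<bar>i - j\<bar> |i j. i \<in> A \<and> j \<in> A}"
    using assms(1) by simp
  then show ?thesis
    unfolding diam_def using assms(2,3) by (intro Max_ge) auto
qed

lemma diam_nonneg: "A \<in> finite_regions \<Longrightarrow> 0 \<le> diam A"
  unfolding finite_regions_def using abs_diff_le_diam[of A] by force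

lemma diam_translate: "diam ((\<lambda>x. x + i) ` A) = diam A"
proof -
  have "{\<bar>x - y\<bar> |x y. x \<in> B \<and> y \<in> B} = (\<lambda>(x, y). \<bar>x - y\<bar>) ` (B \<times> B)" for B :: "int set"
    by auto
  moreover have "(\<lambda>x. x + i) ` A \<times> (\<lambda>x. x + i) ` A = (\<lambda>(x, y). (x + i, y + i)) ` (A \<times> A)"
    by auto
  ultimately show ?thesis
    unfolding diam_def by (simp add: image_image case_prod_unfold)
qed

lemma translate_in_finite_regions_iff:
  "(\<lambda>x. x + i) ` A \<in> finite_regions \<longleftrightarrow> A \<in> finite_regions"
  by (auto simp: finite_regions_def finite_image_iff)

lemma finite_local_configs: "finite I \<Longrightarrow> finite (local_configs I :: 'a::finite config set)"
  unfolding local_configs_def by (simp add: finite_PiE)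

lemma restrict_in_local_configs: "restrict \<sigma> I \<in> local_configs I"
  unfolding local_configs_def by simp

lemma local_configs_nonempty: "local_configs I \<noteq> {}"
  using restrict_in_local_configs by blast

text \<open>An upper bound \<open>u\<close> for the interaction strength replaces the supremum, so that the
  assumptions are visibly stable under sums of interactions; of the exponential decay only the
  first moment of the diameter is needed.\<close>

locale local_interaction =
  fixes U :: "'a::finite interaction" and u :: "int set \<Rightarrow> real"
  assumes local: "A \<in> finite_regions \<Longrightarrow> (\<And>x. x \<in> A \<Longrightarrow> \<sigma> x = \<sigma>' x) \<Longrightarrow> U A \<sigma> = U A \<sigma>'"
    and translate: "A \<in> finite_regions \<Longrightarrow> U ((\<lambda>x. x + i) ` A) (shift (- i) \<sigma>) = U A \<sigma>"
    and bound: "A \<in> finite_regions \<Longrightarrow> \<bar>U A \<sigma>\<bar> \<le> u A"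
    and bound_translate: "A \<in> finite_regions \<Longrightarrow> u ((\<lambda>x. x + i) ` A) = u A"
    and summable: "(\<lambda>A. (1 + real_of_int (diam A)) * u A) summable_on {A \<in> finite_regions. 0 \<in> A}"

lemma local_interaction_add:
  assumes "local_interaction U u" "local_interaction V v"
  shows "local_interaction (\<lambda>A \<sigma>. U A \<sigma> + V A \<sigma>) (\<lambda>A. u A + v A)"
proof -
  interpret U: local_interaction U u by fact
  interpret V: local_interaction V v by fact
  show ?thesis
  proof
    fix A \<sigma> and \<sigma>' :: "'a config"
    assume "A \<in> finite_regions" "\<And>x. x \<in> A \<Longrightarrow> \<sigma> x = \<sigma>' x"
    then show "U A \<sigma> + V A \<sigma> = U A \<sigma>' + V A \<sigma>'"
      using U.local[of A \<sigma> \<sigma>'] V.local[of A \<sigma> \<sigma>'] by simp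
  next
    fix A \<sigma> assume "A \<in> finite_regions"
    then show "\<bar>U A \<sigma> + V A \<sigma>\<bar> \<le> u A + v A"
      using U.bound[of A \<sigma>] V.bound[of A \<sigma>] by linarith
  next
    show "(\<lambda>A. (1 + real_of_int (diam A)) * (u A + v A)) summable_on {A \<in> finite_regions. 0 \<in> A}"
      using summable_on_add[OF U.summable V.summable] by (simp add: distrib_left)
  qed (simp_all add: U.translate V.translate U.bound_translate V.bound_translate)
qed

section \<open>Locality and summability of the given interactions\<close>

text \<open>The sets that do not separate \<open>\<sigma>\<close> from \<open>\<sigma>'\<close>
  contain the generators and are closed under complements and countable unions.\<close>

lemma coord_algebra_local:
  assumes "S \<in> sets (coord_algebra W)" "\<forall>x\<in>W. \<sigma> x = \<sigma>' x"
  shows "\<sigma> \<in> S \<longleftrightarrow> \<sigma>' \<in> S"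
proof -
  have "S \<in> sigma_sets UNIV {(\<lambda>\<sigma>. \<sigma> i) -` B | i B. i \<in> W}"
    using assms(1) unfolding coord_algebra_def by (simp add: sets_measure_of_conv)
  then show ?thesis
    by induction (use assms(2) in auto)
qed

text \<open>Measurability makes the level sets of \<open>U A\<close> depend on the coordinates in
  \<open>A\<close> only, which is locality. So \<open>U A\<close> factors through the finite set
  \<open>local_configs A\<close>, its supremum is a genuine bound, and exponential summability
  dominates the first moment of the diameter.\<close>

lemma interactions_local_interaction:
  fixes U :: "'a::finite interaction"
  assumes "U \<in> interactions"
  shows "local_interaction U (\<lambda>A. SUP \<sigma>. \<bar>U A \<sigma>\<bar>)"
proof -
  obtain \<gamma> where meas: "\<And>A. A \<in> finite_regions \<Longrightarrow> U A \<in> borel_measurable (coord_algebra A)"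
    and trans: "\<And>A i \<sigma>. A \<in> finite_regions \<Longrightarrow> U ((\<lambda>x. x + i) ` A) (shift (- i) \<sigma>) = U A \<sigma>"
    and \<gamma>: "\<gamma> > 0" and summ: "(\<lambda>A. exp (\<gamma> * real_of_int (diam A)) * (SUP \<sigma>. \<bar>U A \<sigma>\<bar>))
        summable_on {A \<in> finite_regions. 0 \<in> A}"
    using assms unfolding interactions_def by blast
  have loc: "U A \<sigma> = U A \<sigma>'" if "A \<in> finite_regions" "\<And>x. x \<in> A \<Longrightarrow> \<sigma> x = \<sigma>' x" for A \<sigma> \<sigma>'
  proof -
    have "{\<tau>. U A \<tau> = U A \<sigma>} \<in> sets (coord_algebra A)"
      using measurable_sets[OF meas[OF that(1)], of "{U A \<sigma>}"]
      by (simp add: coord_algebra_def vimage_def space_measure_of_conv)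
    from coord_algebra_local[OF this, of \<sigma> \<sigma>'] that(2) show ?thesis by auto
  qed
  have fin: "finite (range (\<lambda>\<sigma>. \<bar>U A \<sigma>\<bar>))" if A: "A \<in> finite_regions" for A
  proof (rule finite_subset)
    show "range (\<lambda>\<sigma>. \<bar>U A \<sigma>\<bar>) \<subseteq> (\<lambda>\<sigma>. \<bar>U A \<sigma>\<bar>) ` local_configs A"
    proof
      fix y assume "y \<in> range (\<lambda>\<sigma>. \<bar>U A \<sigma>\<bar>)"
      then obtain \<sigma> where "y = \<bar>U A \<sigma>\<bar>" by auto
      moreover have "U A \<sigma> = U A (restrict \<sigma> A)"
        by (rule loc[OF A]) simp
      ultimately show "y \<in> (\<lambda>\<sigma>. \<bar>U A \<sigma>\<bar>) ` local_configs A"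
        using restrict_in_local_configs by fastforce
    qed
    show "finite ((\<lambda>\<sigma>. \<bar>U A \<sigma>\<bar>) ` local_configs A)"
      using A by (intro finite_imageI finite_local_configs) (simp add: finite_regions_def)
  qed
  have bd: "\<bar>U A \<sigma>\<bar> \<le> (SUP \<sigma>. \<bar>U A \<sigma>\<bar>)" if "A \<in> finite_regions" for A \<sigma>
    using fin[OF that] by (intro cSUP_upper bounded_imp_bdd_above finite_imp_bounded) auto
  show ?thesis
  proof
    fix A i assume A: "A \<in> finite_regions"
    have shift_shift: "shift (- i) (shift i \<sigma>) = \<sigma>" for \<sigma> :: "'a config"
      by (simp add: shift_def)
    have "range (\<lambda>\<sigma>. \<bar>U ((\<lambda>x. x + i) ` A) \<sigma>\<bar>) = range (\<lambda>\<sigma>. \<bar>U A \<sigma>\<bar>)"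
    proof (intro equalityI image_subsetI)
      fix \<sigma> :: "'a config"
      show "\<bar>U ((\<lambda>x. x + i) ` A) \<sigma>\<bar> \<in> range (\<lambda>\<sigma>. \<bar>U A \<sigma>\<bar>)"
        using trans[OF A, of i "shift i \<sigma>"] by (simp add: shift_shift)
      show "\<bar>U A \<sigma>\<bar> \<in> range (\<lambda>\<sigma>. \<bar>U ((\<lambda>x. x + i) ` A) \<sigma>\<bar>)"
        using trans[OF A, of i \<sigma>] by (metis rangeI)
    qed
    then show "(SUP \<sigma>. \<bar>U ((\<lambda>x. x + i) ` A) \<sigma>\<bar>) = (SUP \<sigma>. \<bar>U A \<sigma>\<bar>)"
      by simp
  next
    let ?S = "{A \<in> finite_regions. 0 \<in> A}"
    \<comment> \<open>The constant comes from \<open>1 \<le> exp (\<gamma> * d)\<close> and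
      \<open>d \<le> exp (\<gamma> * d) / \<gamma>\<close>, added for \<open>d\<close> the
      diameter.\<close>
    have "(\<lambda>A. (1 + 1 / \<gamma>) * (exp (\<gamma> * real_of_int (diam A)) * (SUP \<sigma>. \<bar>U A \<sigma>\<bar>))) summable_on ?S"
      by (intro summable_on_cmult_right summ)
    then show "(\<lambda>A. (1 + real_of_int (diam A)) * (SUP \<sigma>. \<bar>U A \<sigma>\<bar>)) summable_on ?S"
    proof (rule summable_on_comparison_test)
      fix A assume "A \<in> ?S"
      then have A: "A \<in> finite_regions" by simp
      have nonneg: "0 \<le> (SUP \<sigma>. \<bar>U A \<sigma>\<bar>)"
        using bd[OF A, of undefined] by linarith
      have d: "0 \<le> real_of_int (diam A)"
        using diam_nonneg[OF A] by simp
      have "\<gamma> * real_of_int (diam A) \<le> exp (\<gamma> * real_of_int (diam A))"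
        using exp_ge_add_one_self[of "\<gamma> * real_of_int (diam A)"] by linarith
      then have "real_of_int (diam A) \<le> 1 / \<gamma> * exp (\<gamma> * real_of_int (diam A))"
        using \<gamma> by (simp add: field_simps)
      moreover have "1 \<le> exp (\<gamma> * real_of_int (diam A))"
        using \<gamma> d by simp
      ultimately have "1 + real_of_int (diam A) \<le> (1 + 1 / \<gamma>) * exp (\<gamma> * real_of_int (diam A))"
        unfolding distrib_right by linarith
      from mult_right_mono[OF this nonneg] show "(1 + real_of_int (diam A)) * (SUP \<sigma>. \<bar>U A \<sigma>\<bar>)
          \<le> (1 + 1 / \<gamma>) * (exp (\<gamma> * real_of_int (diam A)) * (SUP \<sigma>. \<bar>U A \<sigma>\<bar>))"
        by (simp add: mult.assoc)
      show "0 \<le> (1 + real_of_int (diam A)) * (SUP \<sigma>. \<bar>U A \<sigma>\<bar>)"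
        using d nonneg by simp
    qed
  qed (use loc trans bd in blast)+
qed

section \<open>Free-boundary energies and interaction sums through a site or a cut\<close>

text \<open>This is the energy with free boundary: only regions inside \<open>I\<close> count,
  whereas \<open>hamiltonian\<close> includes all regions that meet the volume. Its partition
  function is the sum in the definition of \<open>pressure\<close>.\<close>

definition energy :: "'a::finite interaction \<Rightarrow> int set \<Rightarrow> 'a config \<Rightarrow> real" where
  "energy U I \<sigma> = (\<Sum>A\<in>{A \<in> finite_regions. A \<subseteq> I}. U A \<sigma>)"

definition partition_fun :: "'a::finite interaction \<Rightarrow> int set \<Rightarrow> real" where
  "partition_fun U I = (\<Sum>\<sigma>\<in>local_configs I. exp (- energy U I \<sigma>))"

text \<open>These are the regions whose terms are lost when an interval is cut between
  \<open>c\<close> and \<open>c + 1\<close>.\<close>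

definition crossing :: "int \<Rightarrow> int set set" where
  "crossing c = {A \<in> finite_regions. (\<exists>x\<in>A. x \<le> c) \<and> (\<exists>y\<in>A. c < y)}"

lemma partition_fun_pos: "finite I \<Longrightarrow> 0 < partition_fun U I"
  unfolding partition_fun_def
  by (intro sum_pos finite_local_configs local_configs_nonempty) auto

lemma finite_subregions: "finite I \<Longrightarrow> finite {A \<in> finite_regions. A \<subseteq> I}"
  by (rule finite_subset[of _ "Pow I"]) auto

context local_interaction
begin

text \<open>The weight serves two counts at once: the summand 1 handles the regions through a fixed
  site, and the diameter handles the translates of a shape across a fixed cut.\<close>

definition strength :: real where
  "strength = (\<Sum>\<^sub>\<infinity>A\<in>{A \<in> finite_regions. 0 \<in> A}. (1 + real_of_int (diam A)) * u A)"

lemma bound_nonneg: "A \<in> finite_regions \<Longrightarrow> 0 \<le> u A"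
  using bound[of A undefined] by linarith

lemma finite_sum_le_strength:
  assumes "finite F" "F \<subseteq> {A \<in> finite_regions. 0 \<in> A}"
  shows "(\<Sum>A\<in>F. (1 + real_of_int (diam A)) * u A) \<le> strength"
  unfolding strength_def
  by (rule finite_sum_le_infsum[OF summable assms]) (simp add: diam_nonneg bound_nonneg)

text \<open>Translation by \<open>- x\<close> maps the regions through \<open>x\<close> injectively
  to regions through the origin and preserves \<open>u\<close>.\<close>

lemma sum_bound_site_le:
  assumes "finite F" "F \<subseteq> {A \<in> finite_regions. x \<in> A}"
  shows "sum u F \<le> strength"
proof -
  let ?f = "(`) (\<lambda>y. y + (- x)) :: int set \<Rightarrow> int set"
  have inj: "inj_on ?f F"
    by (intro inj_onI) (simp add: inj_image_eq_iff)
  have F: "A \<in> finite_regions" "x \<in> A" if "A \<in> F" for A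
    using assms(2) that by auto
  have "sum u F = (\<Sum>A\<in>?f ` F. u A)"
    using inj F by (simp add: sum.reindex bound_translate del: add_uminus_conv_diff)
  also have "\<dots> \<le> (\<Sum>A\<in>?f ` F. (1 + real_of_int (diam A)) * u A)"
  proof (rule sum_mono)
    fix A assume "A \<in> ?f ` F"
    then have "A \<in> finite_regions"
      using F translate_in_finite_regions_iff by blast
    then show "u A \<le> (1 + real_of_int (diam A)) * u A"
      using diam_nonneg bound_nonneg by (simp add: distrib_right)
  qed
  also have "\<dots> \<le> strength"
  proof (rule finite_sum_le_strength)
    show "finite (?f ` F)"
      using assms(1) by simp
    show "?f ` F \<subseteq> {A \<in> finite_regions. 0 \<in> A}"
      using F by (force simp: translate_in_finite_regions_iff simp del: add_uminus_conv_diff)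
  qed
  finally show ?thesis .
qed

text \<open>A translate of a region \<open>B\<close> containing the origin as its minimum crosses a given
  boundary point in at most \<open>diam B\<close> ways.\<close>

lemma sum_bound_crossing_le:
  assumes "finite F" "F \<subseteq> crossing c"
  shows "sum u F \<le> strength"
proof -
  define f :: "int set \<Rightarrow> int set" where "f A = (\<lambda>y. y + (- Min A)) ` A" for A
  have F: "A \<in> finite_regions" "f A \<in> finite_regions" "0 \<in> f A" "u (f A) = u A"
    "c - Min A \<in> {0..<diam (f A)}" if "A \<in> F" for A
  proof -
    show A: "A \<in> finite_regions"
      using that assms(2) unfolding crossing_def by auto
    show "f A \<in> finite_regions" "u (f A) = u A"
      using A unfolding f_def by (simp_all only: translate_in_finite_regions_iff bound_translate)
    have fin: "finite A" "A \<noteq> {}"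
      using A unfolding finite_regions_def by auto
    then have "Min A \<in> A" by simp
    then show "0 \<in> f A" unfolding f_def by force
    obtain x y where "x \<in> A" "x \<le> c" "y \<in> A" "c < y"
      using \<open>A \<in> F\<close> assms(2) unfolding crossing_def by blast
    moreover have "Min A \<le> x" "\<bar>y - Min A\<bar> \<le> diam A"
      using fin \<open>x \<in> A\<close> abs_diff_le_diam[OF fin(1) \<open>y \<in> A\<close> \<open>Min A \<in> A\<close>] by simp_all
    ultimately show "c - Min A \<in> {0..<diam (f A)}"
      unfolding f_def diam_translate by simp
  qed
  \<comment> \<open>A region is determined by its shape, translated to have minimum 0, and by the
    position of the cut relative to its minimum.\<close>
  have inj: "inj_on (\<lambda>A. (f A, c - Min A)) F"
  proof (rule inj_onI)
    fix A B assume "A \<in> F" "B \<in> F" "(f A, c - Min A) = (f B, c - Min B)"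
    then have "(\<lambda>y. y + (- Min B)) ` A = (\<lambda>y. y + (- Min B)) ` B"
      unfolding f_def by auto
    then show "A = B"
      by (rule inj_image_eq_iff[THEN iffD1, rotated]) simp
  qed
  have "sum u F = (\<Sum>A\<in>F. u (f A))"
    using F(4) by simp
  also have "\<dots> = (\<Sum>(B, d)\<in>(\<lambda>A. (f A, c - Min A)) ` F. u B)"
    using inj by (simp add: sum.reindex)
  \<comment> \<open>All admissible cut positions are allowed for each shape \<open>B\<close>; there
    are \<open>diam B\<close> of them, and the added terms are nonnegative.\<close>
  also have "\<dots> \<le> (\<Sum>(B, d)\<in>Sigma (f ` F) (\<lambda>B. {0..<diam B}). u B)"
  proof (rule sum_mono2)
    show "finite (Sigma (f ` F) (\<lambda>B. {0..<diam B}))"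
      using assms(1) by blast
    show "(\<lambda>A. (f A, c - Min A)) ` F \<subseteq> Sigma (f ` F) (\<lambda>B. {0..<diam B})"
      using F(5) by auto
    show "0 \<le> (case z of (B, d) \<Rightarrow> u B)"
      if "z \<in> Sigma (f ` F) (\<lambda>B. {0..<diam B}) - (\<lambda>A. (f A, c - Min A)) ` F" for z
      using that F(2) bound_nonneg by auto
  qed
  also have "\<dots> = (\<Sum>B\<in>f ` F. \<Sum>d\<in>{0..<diam B}. u B)"
    by (rule sum.Sigma[symmetric]) (use assms(1) in auto)
  also have "\<dots> \<le> (\<Sum>B\<in>f ` F. (1 + real_of_int (diam B)) * u B)"
  proof (rule sum_mono)
    fix B assume "B \<in> f ` F"
    then have "B \<in> finite_regions"
      using F(2) by blast
    then show "(\<Sum>d\<in>{0..<diam B}. u B) \<le> (1 + real_of_int (diam B)) * u B"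
      using diam_nonneg bound_nonneg by (simp add: distrib_right)
  qed
  also have "\<dots> \<le> strength"
    by (rule finite_sum_le_strength) (use assms(1) F in auto)
  finally show ?thesis .
qed

text \<open>A region that meets the interval without lying inside it crosses the cut at
  \<open>a - 1\<close> or the cut at \<open>b\<close>. Each cut contributes at most
  \<open>strength\<close>, uniformly in the boundary condition \<open>\<zeta>\<close>.\<close>

lemma hamiltonian_energy:
  assumes "a \<le> b"
  shows "\<bar>hamiltonian U {a..b} \<zeta> \<xi> - energy U {a..b} \<xi>\<bar> \<le> 2 * strength"
proof -
  let ?\<omega> = "override_on \<zeta> \<xi> {a..b}"
  let ?I = "{A \<in> finite_regions. A \<subseteq> {a..b}}"
  let ?X = "{A \<in> finite_regions. A \<inter> {a..b} \<noteq> {} \<and> \<not> A \<subseteq> {a..b}}"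
  have X: "?X \<subseteq> crossing (a - 1) \<union> crossing b"
  proof
    fix A assume A: "A \<in> ?X"
    then obtain x y where "x \<in> A \<inter> {a..b}" "y \<in> A - {a..b}"
      by blast
    then have "x \<in> A" "a \<le> x" "x \<le> b" "y \<in> A" "y < a \<or> b < y"
      by auto
    then show "A \<in> crossing (a - 1) \<union> crossing b"
      using A by (force simp: crossing_def)
  qed
  have le: "sum u F \<le> 2 * strength" if F: "finite F" "F \<subseteq> ?X" for F
  proof -
    have "F = (F \<inter> crossing (a - 1)) \<union> (F - crossing (a - 1))" by blast
    then have "sum u F = sum u (F \<inter> crossing (a - 1)) + sum u (F - crossing (a - 1))"
      using F(1) by (metis Diff_disjoint finite_Diff finite_Int inf_assoc inf_bot_right sum.Int_Diff)
    moreover have "sum u (F \<inter> crossing (a - 1)) \<le> strength"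
      by (rule sum_bound_crossing_le) (use F in auto)
    moreover have "sum u (F - crossing (a - 1)) \<le> strength"
      by (rule sum_bound_crossing_le) (use F X in blast)+
    ultimately show ?thesis by linarith
  qed
  \<comment> \<open>Infinitely many regions may leave the interval; the uniform bound on finite
    subsums makes their series absolutely convergent and carries over to the limit.\<close>
  have summ_u: "u summable_on ?X"
    by (rule nonneg_bdd_above_summable_on)
      (use le in \<open>auto simp: bound_nonneg intro!: bdd_aboveI2[of _ _ "2 * strength"]\<close>)
  have abs: "(\<lambda>A. norm (U A ?\<omega>)) summable_on ?X"
    by (rule Infinite_Sum.abs_summable_on_comparison_test'[OF summ_u]) (simp add: bound)
  have "norm (\<Sum>\<^sub>\<infinity>A\<in>?X. U A ?\<omega>) \<le> (\<Sum>\<^sub>\<infinity>A\<in>?X. norm (U A ?\<omega>))"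
    by (rule norm_infsum_bound[OF abs])
  also have "\<dots> \<le> (\<Sum>\<^sub>\<infinity>A\<in>?X. u A)"
    by (rule infsum_mono[OF abs summ_u]) (simp add: bound)
  also have "\<dots> \<le> 2 * strength"
    by (rule infsum_le_finite_sums[OF summ_u le])
  finally have X_le: "\<bar>\<Sum>\<^sub>\<infinity>A\<in>?X. U A ?\<omega>\<bar> \<le> 2 * strength"
    by simp
  have "{A \<in> finite_regions. A \<inter> {a..b} \<noteq> {}} = ?I \<union> ?X"
    by (auto simp: finite_regions_def)
  then have "hamiltonian U {a..b} \<zeta> \<xi> = (\<Sum>\<^sub>\<infinity>A\<in>?I \<union> ?X. U A ?\<omega>)"
    unfolding hamiltonian_def by simp
  also have "\<dots> = (\<Sum>\<^sub>\<infinity>A\<in>?I. U A ?\<omega>) + (\<Sum>\<^sub>\<infinity>A\<in>?X. U A ?\<omega>)"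
    by (rule infsum_Un_disjoint)
      (use abs_summable_summable[OF abs] finite_subregions in auto)
  also have "(\<Sum>\<^sub>\<infinity>A\<in>?I. U A ?\<omega>) = (\<Sum>A\<in>?I. U A ?\<omega>)"
    using finite_subregions by simp
  also have "\<dots> = energy U {a..b} \<xi>"
    unfolding energy_def by (intro sum.cong refl local) (auto simp: override_on_def)
  finally show ?thesis
    using X_le by simp
qed

lemma energy_local:
  assumes "\<And>x. x \<in> I \<Longrightarrow> \<sigma> x = \<sigma>' x"
  shows "energy U I \<sigma> = energy U I \<sigma>'"
  unfolding energy_def by (intro sum.cong refl local) (use assms in auto)

lemma energy_translate:
  "energy U ((\<lambda>x. x + i) ` I) \<sigma> = energy U I (shift i \<sigma>)"
proof -
  have "energy U I (shift i \<sigma>) =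
      (\<Sum>A\<in>{A \<in> finite_regions. A \<subseteq> I}. U ((\<lambda>x. x + i) ` A) (shift (- i) (shift i \<sigma>)))"
    unfolding energy_def by (intro sum.cong refl) (simp add: translate)
  also have "\<dots> = (\<Sum>A\<in>{A \<in> finite_regions. A \<subseteq> I}. U ((\<lambda>x. x + i) ` A) \<sigma>)"
    by (simp add: shift_def)
  also have "\<dots> = (\<Sum>A\<in>(`) (\<lambda>x. x + i) ` {A \<in> finite_regions. A \<subseteq> I}. U A \<sigma>)"
    by (simp add: sum.reindex inj_on_def inj_image_eq_iff)
  also have "(`) (\<lambda>x. x + i) ` {A \<in> finite_regions. A \<subseteq> I} =
      {A \<in> finite_regions. A \<subseteq> (\<lambda>x. x + i) ` I}"
  proof (intro equalityI subsetI)
    fix A assume "A \<in> (`) (\<lambda>x. x + i) ` {A \<in> finite_regions. A \<subseteq> I}"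
    then show "A \<in> {A \<in> finite_regions. A \<subseteq> (\<lambda>x. x + i) ` I}"
      by (auto simp: translate_in_finite_regions_iff)
  next
    fix A assume "A \<in> {A \<in> finite_regions. A \<subseteq> (\<lambda>x. x + i) ` I}"
    then obtain B where "A = (\<lambda>x. x + i) ` B" "B \<subseteq> I" "A \<in> finite_regions"
      by (auto simp: subset_image_iff)
    then show "A \<in> (`) (\<lambda>x. x + i) ` {A \<in> finite_regions. A \<subseteq> I}"
      by (auto simp: translate_in_finite_regions_iff)
  qed
  finally show ?thesis
    unfolding energy_def by simp
qed

text \<open>The only regions missing from both halves are those crossing the cut at
  \<open>b\<close>. The half-open numbering permits empty halves.\<close>

lemma energy_split:
  assumes "a \<le> b" "b \<le> c"
  shows "\<bar>energy U {a+1..c} \<sigma> - energy U {a+1..b} \<sigma> - energy U {b+1..c} \<sigma>\<bar> \<le> strength"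
proof -
  let ?R = "\<lambda>I. {A \<in> finite_regions. A \<subseteq> I}"
  let ?X = "?R {a+1..c} \<inter> crossing b"
  have fin: "finite (?R I)" if "finite I" for I :: "int set"
    using finite_subregions that .
  have eq: "?R {a+1..c} = (?R {a+1..b} \<union> ?R {b+1..c}) \<union> ?X"
  proof (intro equalityI subsetI)
    fix A assume "A \<in> ?R {a+1..c}"
    then show "A \<in> (?R {a+1..b} \<union> ?R {b+1..c}) \<union> ?X"
      by (force simp: crossing_def not_le)
  qed (use assms in force)
  \<comment> \<open>The empty set would lie in both halves, but \<open>finite_regions\<close>
    excludes it.\<close>
  have disj: "?R {a+1..b} \<inter> ?R {b+1..c} = {}" "(?R {a+1..b} \<union> ?R {b+1..c}) \<inter> ?X = {}"
    by (force simp: finite_regions_def crossing_def)+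
  have "energy U {a+1..c} \<sigma> = energy U {a+1..b} \<sigma> + energy U {b+1..c} \<sigma> + (\<Sum>A\<in>?X. U A \<sigma>)"
  proof -
    have "energy U {a+1..c} \<sigma> = (\<Sum>A\<in>(?R {a+1..b} \<union> ?R {b+1..c}) \<union> ?X. U A \<sigma>)"
      unfolding energy_def by (rule sum.cong[OF eq refl])
    also have "\<dots> = (\<Sum>A\<in>?R {a+1..b} \<union> ?R {b+1..c}. U A \<sigma>) + (\<Sum>A\<in>?X. U A \<sigma>)"
      using disj(2) fin by (intro sum.union_disjoint) auto
    also have "(\<Sum>A\<in>?R {a+1..b} \<union> ?R {b+1..c}. U A \<sigma>) = energy U {a+1..b} \<sigma> + energy U {b+1..c} \<sigma>"
      unfolding energy_def using disj(1) fin by (intro sum.union_disjoint) auto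
    finally show ?thesis .
  qed
  moreover have "\<bar>\<Sum>A\<in>?X. U A \<sigma>\<bar> \<le> sum u ?X"
    by (rule order_trans[OF sum_abs sum_mono]) (simp add: bound)
  moreover have "sum u ?X \<le> strength"
    by (rule sum_bound_crossing_le) (use fin in auto)
  ultimately show ?thesis by linarith
qed

text \<open>Only regions meeting \<open>S\<close> feel the change, each by at most
  \<open>2 * u A\<close>; a union bound over the sites of \<open>S\<close> then gives one
  \<open>strength\<close> per site, doubled.\<close>

lemma energy_change_le:
  assumes "finite I" "finite S" "\<And>x. x \<notin> S \<Longrightarrow> \<sigma> x = \<sigma>' x"
  shows "energy U I \<sigma> - energy U I \<sigma>' \<le> 2 * strength * real (card S)"
proof -
  let ?X = "\<lambda>x. {A \<in> finite_regions. A \<subseteq> I \<and> x \<in> A}"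
  let ?R = "{A \<in> finite_regions. A \<subseteq> I}"
  have fin: "finite ?R"
    using finite_subregions assms(1) by simp
  have "energy U I \<sigma> - energy U I \<sigma>' = (\<Sum>A\<in>?R. U A \<sigma> - U A \<sigma>')"
    unfolding energy_def by (simp add: sum_subtractf)
  also have "\<dots> = (\<Sum>A\<in>(\<Union>x\<in>S. ?X x). U A \<sigma> - U A \<sigma>')"
  proof (rule sum.mono_neutral_right[OF fin])
    show "(\<Union>x\<in>S. ?X x) \<subseteq> ?R" by blast
    show "\<forall>A\<in>?R - (\<Union>x\<in>S. ?X x). U A \<sigma> - U A \<sigma>' = 0"
    proof
      fix A assume A: "A \<in> ?R - (\<Union>x\<in>S. ?X x)"
      have "U A \<sigma> = U A \<sigma>'"
        by (rule local) (use A assms(3) in blast)+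
      then show "U A \<sigma> - U A \<sigma>' = 0" by simp
    qed
  qed
  also have "\<dots> \<le> (\<Sum>A\<in>(\<Union>x\<in>S. ?X x). 2 * u A)"
  proof (rule sum_mono)
    fix A assume "A \<in> (\<Union>x\<in>S. ?X x)"
    then have "A \<in> finite_regions" by blast
    from bound[OF this, of \<sigma>] bound[OF this, of \<sigma>']
    show "U A \<sigma> - U A \<sigma>' \<le> 2 * u A" by linarith
  qed
  also have "\<dots> \<le> (\<Sum>x\<in>S. \<Sum>A\<in>?X x. 2 * u A)"
  proof -
    have UN: "(\<Union>x\<in>S. ?X x) = snd ` Sigma S ?X"
      by force
    have finX: "finite (?X x)" for x
      using fin by (rule rev_finite_subset) blast
    have "(\<Sum>A\<in>(\<Union>x\<in>S. ?X x). 2 * u A) \<le> sum ((\<lambda>A. 2 * u A) \<circ> snd) (Sigma S ?X)"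
      unfolding UN by (rule sum_image_le) (use assms(2) finX bound_nonneg in auto)
    also have "\<dots> = (\<Sum>x\<in>S. \<Sum>A\<in>?X x. 2 * u A)"
      using assms(2) finX by (subst sum.Sigma) (auto simp: case_prod_unfold)
    finally show ?thesis .
  qed
  also have "\<dots> \<le> (\<Sum>x\<in>S. 2 * strength)"
  proof (rule sum_mono)
    fix x
    have "sum u (?X x) \<le> strength"
      by (rule sum_bound_site_le) (use fin in \<open>auto intro: rev_finite_subset\<close>)
    then show "(\<Sum>A\<in>?X x. 2 * u A) \<le> 2 * strength"
      by (simp add: sum_distrib_left[symmetric])
  qed
  finally show ?thesis
    by (simp add: mult.commute)
qed

end

subsection \<open>Partition functions and the pressure\<close>

text \<open>Both \<open>a m / m\<close> and \<open>a n / n\<close> are compared with the same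
  quotient at \<open>m * n\<close>, which makes the quotients a Cauchy sequence. Letting
  \<open>m\<close> tend to infinity for fixed \<open>n\<close> then bounds the distance to the limit
  with the same constant \<open>D\<close>.\<close>

lemma near_additive_limit:
  fixes a :: "nat \<Rightarrow> real"
  assumes near: "\<And>m n. m > 0 \<Longrightarrow> n > 0 \<Longrightarrow> \<bar>a (m + n) - a m - a n\<bar> \<le> D"
  obtains L where "(\<lambda>n. a n / real n) \<longlonglongrightarrow> L" "\<And>n. n > 0 \<Longrightarrow> \<bar>a n - real n * L\<bar> \<le> D"
proof -
  have D: "D \<ge> 0"
    using near[of 1 1] by linarith
  \<comment> \<open>Joining \<open>Suc m\<close> blocks of length \<open>n\<close> takes
    \<open>m\<close> additions, each with an error of at most \<open>D\<close>.\<close>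
  have mult: "\<bar>a (Suc m * n) - real (Suc m) * a n\<bar> \<le> real m * D" if "n > 0" for m n
  proof (induction m)
    case (Suc m)
    have "\<bar>a (Suc (Suc m) * n) - a n - a (Suc m * n)\<bar> \<le> D"
      using near[of n "Suc m * n"] that by simp
    moreover have "real (Suc (Suc m)) * a n = real (Suc m) * a n + a n"
      "real (Suc m) * D = real m * D + D"
      by (simp_all add: algebra_simps)
    ultimately show ?case
      using Suc by linarith
  qed simp
  have quot: "\<bar>a (m * n) / real (m * n) - a n / real n\<bar> \<le> D / real n" if "m > 0" "n > 0" for m n
  proof -
    obtain m' where m: "m = Suc m'"
      using \<open>m > 0\<close> gr0_conv_Suc by blast
    have "\<bar>a (m * n) - real m * a n\<bar> \<le> real m * D"
      using mult[OF \<open>n > 0\<close>, of m'] D unfolding m by (simp add: algebra_simps)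
    moreover have "a (m * n) / real (m * n) - a n / real n = (a (m * n) - real m * a n) / (real m * real n)"
      using that by (simp add: field_simps)
    ultimately show ?thesis
      using that by (simp add: abs_mult field_simps)
  qed
  have cauchy: "\<bar>a m / real m - a n / real n\<bar> \<le> D / real m + D / real n" if "m > 0" "n > 0" for m n
    using quot[OF that] quot[OF that(2,1)] by (simp only: mult.commute[of n m])
  have "Cauchy (\<lambda>n. a n / real n)"
  proof (rule metric_CauchyI)
    fix e :: real assume e: "e > 0"
    obtain M :: nat where M: "2 * D / e < real M"
      using reals_Archimedean2 by blast
    have small: "D / real n < e / 2" if "n > M" for n
    proof -
      have "2 * D / e < real n"
        using M that by simp
      then show ?thesis
        using e that by (simp add: field_simps)
    qed
    have "dist (a m / real m) (a n / real n) < e" if "m > M" "n > M" for m n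
      using cauchy[of m n] small[of m] small[of n] that unfolding dist_real_def by linarith
    then show "\<exists>M. \<forall>m\<ge>M. \<forall>n\<ge>M. dist (a m / real m) (a n / real n) < e"
      by (intro exI[of _ "Suc M"]) auto
  qed
  then obtain L where L: "(\<lambda>n. a n / real n) \<longlonglongrightarrow> L"
    using Cauchy_convergent convergentD by blast
  have "\<bar>a n - real n * L\<bar> \<le> D" if n: "n > 0" for n
  proof -
    have "(\<lambda>m. \<bar>a m / real m - a n / real n\<bar>) \<longlonglongrightarrow> \<bar>L - a n / real n\<bar>"
      by (intro tendsto_intros L)
    moreover have "(\<lambda>m. D / real m + D / real n) \<longlonglongrightarrow> 0 + D / real n"
      by (intro tendsto_intros lim_const_over_n)
    moreover have "\<forall>\<^sub>F m in sequentially. \<bar>a m / real m - a n / real n\<bar> \<le> D / real m + D / real n"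
      using eventually_gt_at_top[of 0] by eventually_elim (rule cauchy[OF _ n])
    ultimately have "\<bar>L - a n / real n\<bar> \<le> 0 + D / real n"
      by (intro tendsto_le[OF sequentially_bot])
    moreover have "a n - real n * L = - real n * (L - a n / real n)"
      using n by (simp add: field_simps)
    ultimately show ?thesis
      using n by (simp add: abs_mult field_simps)
  qed
  with L show ?thesis
    using that by blast
qed

section \<open>Gluing and translating local configurations\<close>

lemma local_configs_split_bij:
  assumes "I \<inter> J = {}"
  shows "bij_betw (\<lambda>\<sigma>. (restrict \<sigma> I, restrict \<sigma> J))
    (local_configs (I \<union> J) :: 'a::finite config set) (local_configs I \<times> local_configs J)"
proof (rule bij_betw_byWitness[where f' = "\<lambda>(\<alpha>, \<beta>). \<lambda>x. if x \<in> I then \<alpha> x else \<beta> x"])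
  show "(\<lambda>\<sigma>. (restrict \<sigma> I, restrict \<sigma> J)) ` local_configs (I \<union> J) \<subseteq> local_configs I \<times> local_configs J"
    by (auto intro: restrict_in_local_configs)
qed (use assms in \<open>auto simp: local_configs_def PiE_def extensional_def fun_eq_iff restrict_def\<close>)

lemma local_configs_translate_bij:
  "bij_betw (\<lambda>\<sigma>. restrict (shift (- i) \<sigma>) ((\<lambda>x. x + i) ` I))
    (local_configs I :: 'a::finite config set) (local_configs ((\<lambda>x. x + i) ` I))"
proof (rule bij_betw_byWitness[where f' = "\<lambda>\<sigma>. restrict (shift i \<sigma>) I"])
  have i: "x + i \<in> (\<lambda>x. x + i) ` I \<longleftrightarrow> x \<in> I" "x \<in> (\<lambda>x. x + i) ` I \<longleftrightarrow> x - i \<in> I" for x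
    by (auto simp: image_iff algebra_simps intro: bexI[of _ "x - i"])
  show "\<forall>\<sigma>\<in>local_configs I. restrict (shift i (restrict (shift (- i) \<sigma>) ((\<lambda>x. x + i) ` I))) I = \<sigma>"
    by (auto simp: local_configs_def PiE_def extensional_def fun_eq_iff restrict_def shift_def i algebra_simps)
  show "\<forall>\<sigma>\<in>local_configs ((\<lambda>x. x + i) ` I).
      restrict (shift (- i) (restrict (shift i \<sigma>) I)) ((\<lambda>x. x + i) ` I) = \<sigma>"
    by (auto simp: local_configs_def PiE_def extensional_def fun_eq_iff restrict_def shift_def i algebra_simps)
qed (auto intro: restrict_in_local_configs)

context local_interaction
begin

lemma energy_restrict: "energy U I (restrict \<sigma> I) = energy U I \<sigma>"
  by (rule energy_local) simp

lemma energy_restrict_shift: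
  "energy U ((\<lambda>x. x + i) ` I) (restrict (shift (- i) \<sigma>) ((\<lambda>x. x + i) ` I)) = energy U I \<sigma>"
  unfolding energy_restrict energy_translate by (simp add: shift_def)

lemma partition_fun_translate:
  "partition_fun U ((\<lambda>x. x + i) ` I) = partition_fun U I"
  unfolding partition_fun_def
  by (subst sum.reindex_bij_betw[OF local_configs_translate_bij, symmetric])
    (simp only: energy_restrict_shift)

text \<open>The second interval is translated to follow the first, and configurations on the two are
  glued. The product of the partition functions thus becomes one sum over the union, whose exponents
  miss the full energy by at most \<open>strength\<close>.\<close>

lemma partition_fun_split:
  fixes m n :: nat
  shows "partition_fun U {1..int m} * partition_fun U {1..int n} * exp (- strength)
      \<le> partition_fun U {1..int (m + n)}"
    and "partition_fun U {1..int (m + n)}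
      \<le> partition_fun U {1..int m} * partition_fun U {1..int n} * exp strength"
proof -
  let ?I = "{1..int m}" and ?J = "{int m + 1..int m + int n}"
  have J: "?J = (\<lambda>x. x + int m) ` {1..int n}"
    by (simp add: add.commute)
  have prod: "partition_fun U ?I * partition_fun U {1..int n} =
      (\<Sum>\<sigma>\<in>local_configs (?I \<union> ?J). exp (- energy U ?I \<sigma> - energy U ?J \<sigma>))"
  proof -
    have "partition_fun U ?I * partition_fun U {1..int n} = partition_fun U ?I * partition_fun U ?J"
      unfolding J partition_fun_translate ..
    also have "\<dots> = (\<Sum>(\<alpha>, \<beta>)\<in>local_configs ?I \<times> local_configs ?J. exp (- energy U ?I \<alpha> - energy U ?J \<beta>))"
      unfolding partition_fun_def sum_product sum.cartesian_product
      by (intro sum.cong) (auto simp: exp_add[symmetric])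
    also have "\<dots> = (\<Sum>\<sigma>\<in>local_configs (?I \<union> ?J).
        exp (- energy U ?I (restrict \<sigma> ?I) - energy U ?J (restrict \<sigma> ?J)))"
      by (subst sum.reindex_bij_betw[OF local_configs_split_bij, symmetric]) auto
    finally show ?thesis
      by (simp only: energy_restrict)
  qed
  have IJ: "?I \<union> ?J = {1..int (m + n)}"
    by auto
  have e: "\<bar>energy U {1..int (m + n)} \<sigma> - energy U ?I \<sigma> - energy U ?J \<sigma>\<bar> \<le> strength" for \<sigma>
    using energy_split[of 0 "int m" "int (m + n)" \<sigma>] by simp
  show "partition_fun U ?I * partition_fun U {1..int n} * exp (- strength)
      \<le> partition_fun U {1..int (m + n)}"
    unfolding prod IJ unfolding partition_fun_def sum_distrib_right
  proof (rule sum_mono)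
    fix \<sigma> :: "'a config"
    show "exp (- energy U ?I \<sigma> - energy U ?J \<sigma>) * exp (- strength) \<le> exp (- energy U {1..int (m + n)} \<sigma>)"
      unfolding exp_add[symmetric] exp_le_cancel_iff using e[of \<sigma>] by linarith
  qed
  show "partition_fun U {1..int (m + n)}
      \<le> partition_fun U {1..int m} * partition_fun U {1..int n} * exp strength"
    unfolding prod IJ unfolding partition_fun_def sum_distrib_right
  proof (rule sum_mono)
    fix \<sigma> :: "'a config"
    show "exp (- energy U {1..int (m + n)} \<sigma>) \<le> exp (- energy U ?I \<sigma> - energy U ?J \<sigma>) * exp strength"
      unfolding exp_add[symmetric] exp_le_cancel_iff using e[of \<sigma>] by linarith
  qed
qed

lemma ln_partition_fun_pressure:
  fixes n :: nat
  assumes "n > 0"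
  shows "\<bar>ln (partition_fun U {1..int n}) - real n * pressure U\<bar> \<le> strength"
proof -
  have pos: "partition_fun U {1..int n} > 0" for n
    by (rule partition_fun_pos) simp
  have "\<bar>ln (partition_fun U {1..int (m + n)}) - ln (partition_fun U {1..int m})
      - ln (partition_fun U {1..int n})\<bar> \<le> strength" for m n
  proof -
    have "ln (partition_fun U {1..int m} * partition_fun U {1..int n} * exp (- strength))
        \<le> ln (partition_fun U {1..int (m + n)})"
      using partition_fun_split(1)[of m n] pos[of m] pos[of n] pos[of "m + n"] by (subst ln_le_cancel_iff) auto
    moreover have "ln (partition_fun U {1..int (m + n)})
        \<le> ln (partition_fun U {1..int m} * partition_fun U {1..int n} * exp strength)"
      using partition_fun_split(2)[of m n] pos[of m] pos[of n] pos[of "m + n"] by (subst ln_le_cancel_iff) auto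
    moreover have ln_prod: "ln (partition_fun U {1..int m} * partition_fun U {1..int n} * exp c) =
        ln (partition_fun U {1..int m}) + ln (partition_fun U {1..int n}) + c" for c
      using pos[of m] pos[of n] by (simp add: ln_mult)
    ultimately show ?thesis
      unfolding ln_prod by linarith
  qed
  then obtain L where L: "(\<lambda>n. ln (partition_fun U {1..int n}) / real n) \<longlonglongrightarrow> L"
    and near: "\<And>n. n > 0 \<Longrightarrow> \<bar>ln (partition_fun U {1..int n}) - real n * L\<bar> \<le> strength"
    using near_additive_limit[of "\<lambda>n. ln (partition_fun U {1..int n})" strength] by blast
  \<comment> \<open>Since \<open>pressure\<close> is defined by \<open>lim\<close>, it takes the
    intended value only through the convergence just obtained.\<close>
  have "pressure U = L"
    unfolding pressure_def using limI[OF L]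
    by (simp add: partition_fun_def energy_def initial_interval_def)
  then show ?thesis
    using near[OF assms] by simp
qed

text \<open>Changing the letters at the sites of a set \<open>S\<close> costs energy at most \<open>2 * strength\<close> per site;
  the configurations obtained from \<open>\<sigma>\<close> in this way, for all \<open>S \<subseteq> I\<close>, already give the bound.\<close>

lemma partition_fun_lower:
  assumes card: "CARD('a) \<ge> 2" and I: "finite I" and \<sigma>: "\<sigma> \<in> local_configs I"
  shows "(1 + exp (- 2 * strength)) ^ card I * exp (- energy U I \<sigma>) \<le> partition_fun U I"
proof -
  have "\<exists>b. b \<noteq> a" for a :: 'a
  proof (rule ccontr)
    assume "\<nexists>b. b \<noteq> a"
    then have "(UNIV :: 'a set) = {a}" by auto
    then have "CARD('a) = card {a}" by simp
    then show False using card by simp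
  qed
  then obtain other :: "'a \<Rightarrow> 'a" where other: "other a \<noteq> a" for a
    by metis
  define flip where "flip S = (\<lambda>x. if x \<in> S then other (\<sigma> x) else \<sigma> x)" for S
  \<comment> \<open>The set \<open>S\<close> is recovered as the set of sites where
    \<open>flip S\<close> differs from \<open>\<sigma>\<close>, because \<open>other\<close> never
    fixes a letter.\<close>
  have inj: "inj_on flip (Pow I)"
  proof (rule inj_onI)
    fix S T assume "flip S = flip T"
    then have "x \<in> S \<longleftrightarrow> x \<in> T" for x
      using other unfolding flip_def fun_eq_iff by (metis (full_types))
    then show "S = T" by blast
  qed
  have "(1 + exp (- 2 * strength)) ^ card I * exp (- energy U I \<sigma>) =
      (\<Prod>x\<in>I. exp (- 2 * strength) + 1) * exp (- energy U I \<sigma>)"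
    by (simp add: add.commute)
  \<comment> \<open>Expanding the product over sites gives one term per subset \<open>S\<close>, to
    be matched with the configuration \<open>flip S\<close>.\<close>
  also have "\<dots> = (\<Sum>S\<in>Pow I. exp (- 2 * strength) ^ card S * exp (- energy U I \<sigma>))"
    unfolding prod_add[OF I] by (simp add: sum_distrib_right)
  also have "\<dots> \<le> (\<Sum>S\<in>Pow I. exp (- energy U I (flip S)))"
  proof (rule sum_mono)
    fix S assume "S \<in> Pow I"
    then have S: "finite S"
      using I finite_subset by auto
    have "energy U I (flip S) - energy U I \<sigma> \<le> 2 * strength * real (card S)"
      by (rule energy_change_le[OF I S]) (simp add: flip_def)
    then show "exp (- 2 * strength) ^ card S * exp (- energy U I \<sigma>) \<le> exp (- energy U I (flip S))"
      by (simp add: exp_of_nat_mult[symmetric] exp_add[symmetric] mult.commute)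
  qed
  also have "\<dots> = (\<Sum>\<tau>\<in>flip ` Pow I. exp (- energy U I \<tau>))"
    using inj by (simp add: sum.reindex)
  also have "\<dots> \<le> partition_fun U I"
    unfolding partition_fun_def
  proof (rule sum_mono2)
    show "flip ` Pow I \<subseteq> local_configs I"
      using \<sigma> by (auto simp: flip_def local_configs_def PiE_def extensional_def)
  qed (use I finite_local_configs in auto)
  finally show ?thesis .
qed

end

subsection \<open>Cylinder probabilities\<close>

lemma cylinder_sets:
  assumes "sets P = sets (config_space :: 'a::finite config measure)" "finite I" "I \<noteq> {}"
    and "\<xi> \<in> local_configs I"
  shows "{\<sigma>. restrict \<sigma> I = \<xi>} \<in> sets P"
proof -
  have "{\<sigma>. restrict \<sigma> I = \<xi>} = (\<Inter>x\<in>I. (\<lambda>\<sigma>. \<sigma> x) -` {\<xi> x})"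
    using assms(4) by (auto simp: local_configs_def PiE_def extensional_def fun_eq_iff restrict_def)
  moreover have "(\<lambda>\<sigma>::'a config. \<sigma> x) -` {\<xi> x} \<in> sets P" for x
    using measurable_sets[of "\<lambda>\<sigma>::'a config. \<sigma> x" config_space "count_space UNIV" "{\<xi> x}"]
    by (simp add: assms(1) config_space_def space_PiM)
  ultimately show ?thesis
    using assms(2,3) by (simp add: sets.finite_INT)
qed

text \<open>Moving the shift from the configuration to the window makes estimates for cylinders over
  arbitrary intervals applicable to the shifted words in a match.\<close>

lemma shifted_cylinder_eq:
  assumes "\<xi> \<in> local_configs I"
  shows "{\<sigma>. restrict (shift i \<sigma>) I = \<xi>} =
    {\<sigma>. restrict \<sigma> ((\<lambda>x. x + i) ` I) = restrict (shift (- i) \<xi>) ((\<lambda>x. x + i) ` I)}"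
proof (intro Collect_cong)
  fix \<sigma> :: "'a config"
  have "restrict (shift i \<sigma>) I = \<xi> \<longleftrightarrow> (\<forall>x\<in>I. \<sigma> (i + x) = \<xi> x)"
    using assms by (auto simp: local_configs_def PiE_def extensional_def fun_eq_iff restrict_def shift_def)
  also have "\<dots> \<longleftrightarrow> (\<forall>y\<in>(\<lambda>x. x + i) ` I. \<sigma> y = \<xi> (- i + y))"
    by (auto simp: add.commute)
  also have "\<dots> \<longleftrightarrow> restrict \<sigma> ((\<lambda>x. x + i) ` I) = restrict (shift (- i) \<xi>) ((\<lambda>x. x + i) ` I)"
    by (auto simp: fun_eq_iff restrict_def shift_def)
  finally show "restrict (shift i \<sigma>) I = \<xi> \<longleftrightarrow>
      restrict \<sigma> ((\<lambda>x. x + i) ` I) = restrict (shift (- i) \<xi>) ((\<lambda>x. x + i) ` I)" .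
qed

lemma shifted_cylinder_sets:
  assumes "sets P = sets (config_space :: 'a::finite config measure)" "finite I" "I \<noteq> {}"
    and "\<xi> \<in> local_configs I"
  shows "{\<sigma>. restrict (shift i \<sigma>) I = \<xi>} \<in> sets P"
  unfolding shifted_cylinder_eq[OF assms(4)]
  by (rule cylinder_sets) (use assms in \<open>auto intro: restrict_in_local_configs\<close>)

text \<open>The probability of the cylinder is the mean of its conditional probability given the
  outside. The latter is an explicit Gibbs weight, close to the free-boundary weight uniformly in
  \<open>\<zeta>\<close>, so the bounds survive integration.\<close>

lemma (in local_interaction) gibbs_cylinder:
  assumes gibbs: "gibbs_measure U P" and "a \<le> b" and \<xi>: "\<xi> \<in> local_configs {a..b}"
  shows "exp (- 4 * strength) * (exp (- energy U {a..b} \<xi>) / partition_fun U {a..b})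
      \<le> measure P {\<sigma>. restrict \<sigma> {a..b} = \<xi>}" (is ?lower)
    and "measure P {\<sigma>. restrict \<sigma> {a..b} = \<xi>}
      \<le> exp (4 * strength) * (exp (- energy U {a..b} \<xi>) / partition_fun U {a..b})" (is ?upper)
proof -
  let ?I = "{a..b}" and ?C = "{\<sigma>. restrict \<sigma> {a..b} = \<xi>}"
  let ?F = "coord_algebra (- ?I) :: 'a config measure"
  have I: "?I \<in> finite_regions" "finite ?I" "?I \<noteq> {}"
    using \<open>a \<le> b\<close> by (auto simp: finite_regions_def)
  have sets: "sets P = sets config_space"
    using gibbs unfolding gibbs_measure_def by simp
  interpret prob_space P
    using gibbs unfolding gibbs_measure_def by simp
  interpret finite_measure_subalgebra P ?F
    by unfold_locales (rule coord_algebra_subalgebra[OF sets])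
  have C: "?C \<in> sets P"
    using cylinder_sets[OF sets I(2,3) \<xi>] .
  have int_C: "integrable P (indicator ?C :: 'a config \<Rightarrow> real)"
    using C by (simp add: integrable_indicator_iff emeasure_finite less_top[symmetric])
  let ?g = "real_cond_exp P ?F (indicator ?C)"
  have g: "integrable P ?g" "integral\<^sup>L P ?g = measure P ?C"
    using real_cond_exp_int[OF int_C] C by simp_all
  have g_eq: "AE \<zeta> in P. ?g \<zeta> = exp (- hamiltonian U ?I \<zeta> \<xi>) /
      (\<Sum>\<xi>'\<in>local_configs ?I. exp (- hamiltonian U ?I \<zeta> \<xi>'))"
    using gibbs I(1) \<xi> unfolding gibbs_measure_def by fastforce
  have weight: "exp (- 2 * strength) * exp (- energy U ?I \<xi>) \<le> exp (- hamiltonian U ?I \<zeta> \<xi>)"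
    "exp (- hamiltonian U ?I \<zeta> \<xi>) \<le> exp (2 * strength) * exp (- energy U ?I \<xi>)" for \<zeta> \<xi>
    using hamiltonian_energy[OF \<open>a \<le> b\<close>, of \<zeta> \<xi>]
    unfolding exp_add[symmetric] exp_le_cancel_iff by linarith+
  let ?Z = "\<lambda>\<zeta>. \<Sum>\<xi>'\<in>local_configs ?I. exp (- hamiltonian U ?I \<zeta> \<xi>')"
  have Z: "exp (- 2 * strength) * partition_fun U ?I \<le> ?Z \<zeta>"
    "?Z \<zeta> \<le> exp (2 * strength) * partition_fun U ?I" for \<zeta>
    unfolding partition_fun_def sum_distrib_left by (intro sum_mono weight)+
  have pos: "0 < partition_fun U ?I"
    by (rule partition_fun_pos) simp
  then have Z_pos: "0 < ?Z \<zeta>" for \<zeta>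
    using Z(1)[of \<zeta>] by (meson exp_gt_zero less_le_trans mult_pos_pos)
  \<comment> \<open>Numerator and denominator each deviate by a factor
    \<open>exp (2 * strength)\<close> at most; together they give the 4.\<close>
  have split: "exp (- 4 * strength) = exp (- 2 * strength) / exp (2 * strength)"
    "exp (4 * strength) = exp (2 * strength) / exp (- 2 * strength)"
    by (simp_all add: exp_diff[symmetric])
  have "exp (- 4 * strength) * (exp (- energy U ?I \<xi>) / partition_fun U ?I)
      \<le> exp (- hamiltonian U ?I \<zeta> \<xi>) / ?Z \<zeta>" for \<zeta>
    unfolding split(1) times_divide_times_eq by (rule frac_le) (use Z_pos Z weight in auto)
  with g_eq have "AE \<zeta> in P. exp (- 4 * strength) * (exp (- energy U ?I \<xi>) / partition_fun U ?I) \<le> ?g \<zeta>"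
    by (auto elim!: eventually_mono)
  from integral_ge_const[OF g(1) this] show ?lower
    unfolding g(2) .
  have "exp (- hamiltonian U ?I \<zeta> \<xi>) / ?Z \<zeta>
      \<le> exp (4 * strength) * (exp (- energy U ?I \<xi>) / partition_fun U ?I)" for \<zeta>
    unfolding split(2) times_divide_times_eq by (rule frac_le) (use pos Z weight in auto)
  with g_eq have "AE \<zeta> in P. ?g \<zeta> \<le> exp (4 * strength) * (exp (- energy U ?I \<xi>) / partition_fun U ?I)"
    by (auto elim!: eventually_mono)
  from integral_le_const[OF g(1) this] show ?upper
    unfolding g(2) .
qed

lemma (in local_interaction) gibbs_shifted_cylinder:
  assumes "gibbs_measure U P" "1 \<le> k" "\<xi> \<in> local_configs {1..k}"
  shows "exp (- 4 * strength) * (exp (- energy U {1..k} \<xi>) / partition_fun U {1..k})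
      \<le> measure P {\<sigma>. restrict (shift i \<sigma>) {1..k} = \<xi>}"
    and "measure P {\<sigma>. restrict (shift i \<sigma>) {1..k} = \<xi>}
      \<le> exp (4 * strength) * (exp (- energy U {1..k} \<xi>) / partition_fun U {1..k})"
proof -
  let ?\<xi> = "restrict (shift (- i) \<xi>) {1 + i..k + i}"
  have I: "(\<lambda>x. x + i) ` {1..k} = {1 + i..k + i}"
    by simp
  have e: "energy U {1 + i..k + i} ?\<xi> = energy U {1..k} \<xi>"
    "partition_fun U {1 + i..k + i} = partition_fun U {1..k}"
    using energy_restrict_shift[of i "{1..k}" \<xi>] partition_fun_translate[of i "{1..k}"]
    unfolding I by auto
  have "1 + i \<le> k + i" "?\<xi> \<in> local_configs {1 + i..k + i}"
    using assms(2) restrict_in_local_configs unfolding I by auto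
  from gibbs_cylinder[OF assms(1) this]
  show "exp (- 4 * strength) * (exp (- energy U {1..k} \<xi>) / partition_fun U {1..k})
      \<le> measure P {\<sigma>. restrict (shift i \<sigma>) {1..k} = \<xi>}"
    and "measure P {\<sigma>. restrict (shift i \<sigma>) {1..k} = \<xi>}
      \<le> exp (4 * strength) * (exp (- energy U {1..k} \<xi>) / partition_fun U {1..k})"
    unfolding shifted_cylinder_eq[OF assms(3)] I e by auto
qed

section \<open>The expectation as a sum over common words\<close>

text \<open>A match of two words is the disjoint union, over their common value
  \<open>\<xi>\<close>, of rectangles of cylinders; the product measure turns each rectangle into a
  product of probabilities.\<close>

lemma expected_matches_eq_sum:
  fixes P Q :: "'a::finite config measure"
  assumes P: "prob_space P" "sets P = sets config_space"
    and Q: "prob_space Q" "sets Q = sets config_space"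
    and k: "1 \<le> k"
  shows "expected_matches P Q n k =
    (\<Sum>i\<in>{0..n - k}. \<Sum>j\<in>{0..n - k} - {i}. \<Sum>\<xi>\<in>local_configs {1..k}.
      measure P {\<sigma>. restrict (shift i \<sigma>) {1..k} = \<xi>} * measure Q {\<eta>. restrict (shift j \<eta>) {1..k} = \<xi>})"
proof -
  interpret P: prob_space P by fact
  interpret Q: prob_space Q by fact
  interpret PQ: pair_prob_space P Q ..
  let ?A = "\<lambda>i \<xi>. {\<sigma>::'a config. restrict (shift i \<sigma>) {1..k} = \<xi>}"
  let ?L = "local_configs {1..k} :: 'a config set"
  have A: "?A i \<xi> \<in> sets P" "?A i \<xi> \<in> sets Q" if "\<xi> \<in> ?L" for i \<xi>
    using shifted_cylinder_sets[OF P(2) _ _ that] shifted_cylinder_sets[OF Q(2) _ _ that] k by auto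
  have match: "of_bool (restrict (shift i \<sigma>) {1..k} = restrict (shift j \<eta>) {1..k}) =
      (\<Sum>\<xi>\<in>?L. indicator (?A i \<xi> \<times> ?A j \<xi>) (\<sigma>, \<eta>) :: real)" for i j and \<sigma> \<eta> :: "'a config"
  proof -
    let ?\<xi> = "restrict (shift i \<sigma>) {1..k}"
    \<comment> \<open>Only the word actually read off \<open>\<sigma>\<close> can contribute to the
      sum.\<close>
    have "(\<Sum>\<xi>\<in>?L. indicator (?A i \<xi> \<times> ?A j \<xi>) (\<sigma>, \<eta>) :: real) =
        (\<Sum>\<xi>\<in>?L. if \<xi> = ?\<xi> then of_bool (?\<xi> = restrict (shift j \<eta>) {1..k}) else 0)"
      by (intro sum.cong) (auto simp: indicator_def)
    also have "\<dots> = of_bool (?\<xi> = restrict (shift j \<eta>) {1..k})"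
      using finite_local_configs[of "{1..k}"] restrict_in_local_configs by (subst sum.delta) auto
    finally show ?thesis by simp
  qed
  have Times: "integrable (P \<Otimes>\<^sub>M Q) (indicator (?A i \<xi> \<times> ?A j \<xi>) :: _ \<Rightarrow> real)"
    "integral\<^sup>L (P \<Otimes>\<^sub>M Q) (indicator (?A i \<xi> \<times> ?A j \<xi>)) = measure P (?A i \<xi>) * measure Q (?A j \<xi>)"
    if "\<xi> \<in> ?L" for i j \<xi>
  proof -
    have S: "?A i \<xi> \<times> ?A j \<xi> \<in> sets (P \<Otimes>\<^sub>M Q)"
      using A[OF that] by (intro pair_measureI) auto
    then show "integrable (P \<Otimes>\<^sub>M Q) (indicator (?A i \<xi> \<times> ?A j \<xi>) :: _ \<Rightarrow> real)"
      by (simp add: integrable_indicator_iff PQ.emeasure_finite less_top[symmetric])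
    have "measure (P \<Otimes>\<^sub>M Q) (?A i \<xi> \<times> ?A j \<xi>) = measure P (?A i \<xi>) * measure Q (?A j \<xi>)"
      using Q.emeasure_pair_measure_Times[OF A(1)[OF that] A(2)[OF that]]
      by (simp add: measure_def enn2real_mult)
    then show "integral\<^sup>L (P \<Otimes>\<^sub>M Q) (indicator (?A i \<xi> \<times> ?A j \<xi>)) =
        measure P (?A i \<xi>) * measure Q (?A j \<xi>)"
      using S sets.sets_into_space[OF S] by (simp add: Int_absorb2)
  qed
  have "expected_matches P Q n k = (\<integral>\<omega>. (\<Sum>i\<in>{0..n - k}. \<Sum>j\<in>{0..n - k} - {i}. \<Sum>\<xi>\<in>?L.
      indicator (?A i \<xi> \<times> ?A j \<xi>) \<omega>) \<partial>(P \<Otimes>\<^sub>M Q))"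
    unfolding expected_matches_def num_shift_matches_def initial_interval_def case_prod_unfold
      of_nat_sum of_nat_of_bool match prod.collapse ..
  also have "\<dots> = (\<Sum>i\<in>{0..n - k}. \<Sum>j\<in>{0..n - k} - {i}. \<Sum>\<xi>\<in>?L.
      \<integral>\<omega>. indicator (?A i \<xi> \<times> ?A j \<xi>) \<omega> \<partial>(P \<Otimes>\<^sub>M Q))"
    using Times(1) by (simp add: Bochner_Integration.integral_sum Bochner_Integration.integrable_sum)
  also have "\<dots> = (\<Sum>i\<in>{0..n - k}. \<Sum>j\<in>{0..n - k} - {i}. \<Sum>\<xi>\<in>?L.
      measure P (?A i \<xi>) * measure Q (?A j \<xi>))"
    by (intro sum.cong refl Times(2))
  finally show ?thesis .
qed

subsection \<open>Matches\<close>

locale interaction_pair = U: local_interaction U u + V: local_interaction V v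
  for U V :: "'a::finite interaction" and u v :: "int set \<Rightarrow> real"
begin

sublocale W: local_interaction "\<lambda>A \<sigma>. U A \<sigma> + V A \<sigma>" "\<lambda>A. u A + v A"
  by (rule local_interaction_add[OF U.local_interaction_axioms V.local_interaction_axioms])

abbreviation (input) W :: "'a interaction" where
  "W \<equiv> \<lambda>A \<sigma>. U A \<sigma> + V A \<sigma>"

lemma energy_add: "energy W I \<sigma> = energy U I \<sigma> + energy V I \<sigma>"
  by (simp add: energy_def sum.distrib)

text \<open>Each weight \<open>exp (- energy U I \<sigma>)\<close> is at most \<open>c\<close> to
  the power \<open>- n\<close> times the partition function of \<open>U\<close>. Multiplying by the
  weight of \<open>V\<close> and summing compares the partition function of \<open>W\<close> with
  the product of the other two; the growth rates give
  \<open>2 * alpha_tilde U V \<ge> ln c\<close>.\<close>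

lemma alpha_tilde_pos:
  assumes "CARD('a) \<ge> 2"
  shows "0 < alpha_tilde U V"
proof -
  define c where "c = 1 + exp (- 2 * U.strength)"
  \<comment> \<open>This collects the errors of replacing three logarithmic partition functions by
    multiples of the pressures.\<close>
  define K where "K = U.strength + V.strength + W.strength"
  have c: "c > 1"
    unfolding c_def by simp
  have le_K: "real n * (ln c - 2 * alpha_tilde U V) \<le> K" if n: "n > 0" for n :: nat
  proof -
    let ?I = "{1..int n}"
    have Z: "0 < partition_fun U ?I" "0 < partition_fun V ?I" "0 < partition_fun W ?I"
      by (simp_all add: partition_fun_pos)
    have "c ^ n * partition_fun W ?I
        = (\<Sum>\<sigma>\<in>local_configs ?I. c ^ n * exp (- energy U ?I \<sigma>) * exp (- energy V ?I \<sigma>))"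
      unfolding partition_fun_def sum_distrib_left
      by (intro sum.cong refl) (simp add: energy_add exp_add[symmetric])
    also have "\<dots> \<le> (\<Sum>\<sigma>\<in>local_configs ?I. partition_fun U ?I * exp (- energy V ?I \<sigma>))"
      by (intro sum_mono mult_right_mono)
        (use U.partition_fun_lower[OF assms, of ?I] in \<open>simp_all add: c_def\<close>)
    also have "\<dots> = partition_fun U ?I * partition_fun V ?I"
      unfolding partition_fun_def sum_distrib_left ..
    finally have "ln (c ^ n * partition_fun W ?I) \<le> ln (partition_fun U ?I * partition_fun V ?I)"
      using Z c by (subst ln_le_cancel_iff) simp_all
    then have "real n * ln c + ln (partition_fun W ?I)
        \<le> ln (partition_fun U ?I) + ln (partition_fun V ?I)"
      using Z c by (simp add: ln_mult ln_realpow)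
    moreover have "real n * (ln c - 2 * alpha_tilde U V) =
        real n * ln c + real n * pressure W - real n * pressure U - real n * pressure V"
      by (simp add: alpha_tilde_def algebra_simps)
    ultimately show ?thesis
      using U.ln_partition_fun_pressure[OF n] V.ln_partition_fun_pressure[OF n]
        W.ln_partition_fun_pressure[OF n]
      unfolding K_def by linarith
  qed
  \<comment> \<open>A positive gap multiplied by \<open>n\<close> would eventually exceed the fixed
    error \<open>K\<close>.\<close>
  have "ln c \<le> 2 * alpha_tilde U V"
  proof (rule ccontr)
    assume "\<not> ln c \<le> 2 * alpha_tilde U V"
    then have pos: "0 < ln c - 2 * alpha_tilde U V"
      by simp
    then obtain n :: nat where "K < real n * (ln c - 2 * alpha_tilde U V)"
      using reals_Archimedean3 by blast
    also have "\<dots> \<le> real (Suc n) * (ln c - 2 * alpha_tilde U V)"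
      using pos by (intro mult_right_mono) auto
    finally show False
      using le_K[of "Suc n"] by linarith
  qed
  moreover have "ln c > 0"
    using c by simp
  ultimately show ?thesis by linarith
qed

text \<open>This is the probability that independent samples from the free-boundary Gibbs
  distributions of \<open>U\<close> and \<open>V\<close> on \<open>{1..k}\<close> coincide, since
  the energies of \<open>U\<close> and \<open>V\<close> add up to that of \<open>W\<close>.\<close>

definition overlap :: "int \<Rightarrow> real" where
  "overlap k = partition_fun W {1..k} / (partition_fun U {1..k} * partition_fun V {1..k})"

text \<open>The logarithm of each partition function is its pressure times \<open>k\<close> up to
  its \<open>strength\<close>, and the pressures combine to
  \<open>- 2 * alpha_tilde U V\<close>.\<close>

lemma overlap_bounds:
  assumes "1 \<le> k"
  defines "K \<equiv> U.strength + V.strength + W.strength"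
  shows "exp (- K) * exp (- 2 * alpha_tilde U V * real_of_int k) \<le> overlap k"
    and "overlap k \<le> exp K * exp (- 2 * alpha_tilde U V * real_of_int k)"
proof -
  obtain m where m: "k = int m" "m > 0"
    using assms(1) by (metis int_one_le_iff_zero_less not_less zero_less_imp_eq_int of_nat_0_less_iff)
  have Z: "0 < partition_fun U {1..k}" "0 < partition_fun V {1..k}" "0 < partition_fun W {1..k}"
    by (simp_all add: partition_fun_pos)
  have ov: "overlap k = exp (ln (partition_fun W {1..k}) - ln (partition_fun U {1..k})
      - ln (partition_fun V {1..k}))"
    using Z by (simp add: overlap_def exp_diff)
  have "- 2 * alpha_tilde U V * real_of_int k =
      real m * pressure W - real m * pressure U - real m * pressure V"
    by (simp add: alpha_tilde_def m algebra_simps)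
  with U.ln_partition_fun_pressure[OF m(2)] V.ln_partition_fun_pressure[OF m(2)]
    W.ln_partition_fun_pressure[OF m(2)]
  show "exp (- K) * exp (- 2 * alpha_tilde U V * real_of_int k) \<le> overlap k"
    and "overlap k \<le> exp K * exp (- 2 * alpha_tilde U V * real_of_int k)"
    unfolding ov exp_add[symmetric] exp_le_cancel_iff K_def unfolding m by linarith+
qed

text \<open>For every pair of positions the match probability is within a factor \<open>c\<close> of
  \<open>overlap k\<close>, one Gibbs comparison being used for each of \<open>P\<close> and
  \<open>Q\<close>. It remains to count pairs.\<close>

lemma expected_matches_bounds:
  assumes P: "gibbs_measure U P" and Q: "gibbs_measure V Q" and k: "1 \<le> k" "k < n"
  defines "c \<equiv> exp (4 * U.strength + 4 * V.strength)"
  shows "real_of_int ((n - k + 1) * (n - k)) * (overlap k / c) \<le> expected_matches P Q n k"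
    and "expected_matches P Q n k \<le> real_of_int ((n - k + 1) * (n - k)) * (c * overlap k)"
proof -
  let ?L = "local_configs {1..k} :: 'a config set"
  let ?p = "\<lambda>i \<xi>. measure P {\<sigma>. restrict (shift i \<sigma>) {1..k} = \<xi>}"
  let ?q = "\<lambda>i \<xi>. measure Q {\<sigma>. restrict (shift i \<sigma>) {1..k} = \<xi>}"
  let ?w = "\<lambda>\<xi>. exp (- energy U {1..k} \<xi>) / partition_fun U {1..k}"
  let ?x = "\<lambda>\<xi>. exp (- energy V {1..k} \<xi>) / partition_fun V {1..k}"
  have Z: "0 < partition_fun U {1..k}" "0 < partition_fun V {1..k}"
    by (simp_all add: partition_fun_pos)
  have ov: "(\<Sum>\<xi>\<in>?L. ?w \<xi> * ?x \<xi>) = overlap k"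
    unfolding overlap_def partition_fun_def[of W] sum_divide_distrib
    by (intro sum.cong refl) (simp add: energy_add exp_add[symmetric])
  have lower: "overlap k / c \<le> (\<Sum>\<xi>\<in>?L. ?p i \<xi> * ?q j \<xi>)" for i j
  proof -
    have "overlap k / c = (\<Sum>\<xi>\<in>?L. (exp (- 4 * U.strength) * ?w \<xi>) * (exp (- 4 * V.strength) * ?x \<xi>))"
      unfolding ov[symmetric] c_def sum_divide_distrib
      by (intro sum.cong refl) (simp add: exp_add exp_minus field_simps)
    also have "\<dots> \<le> (\<Sum>\<xi>\<in>?L. ?p i \<xi> * ?q j \<xi>)"
      by (intro sum_mono mult_mono U.gibbs_shifted_cylinder[OF P k(1)] V.gibbs_shifted_cylinder[OF Q k(1)])
        (use Z in auto)
    finally show ?thesis .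
  qed
  have upper: "(\<Sum>\<xi>\<in>?L. ?p i \<xi> * ?q j \<xi>) \<le> c * overlap k" for i j
  proof -
    have "(\<Sum>\<xi>\<in>?L. ?p i \<xi> * ?q j \<xi>)
        \<le> (\<Sum>\<xi>\<in>?L. (exp (4 * U.strength) * ?w \<xi>) * (exp (4 * V.strength) * ?x \<xi>))"
      by (intro sum_mono mult_mono U.gibbs_shifted_cylinder[OF P k(1)] V.gibbs_shifted_cylinder[OF Q k(1)])
        (use Z in auto)
    also have "\<dots> = c * overlap k"
      unfolding ov[symmetric] c_def sum_distrib_left
      by (intro sum.cong refl) (simp add: exp_add field_simps)
    finally show ?thesis .
  qed
  have eq: "expected_matches P Q n k =
      (\<Sum>i\<in>{0..n - k}. \<Sum>j\<in>{0..n - k} - {i}. \<Sum>\<xi>\<in>?L. ?p i \<xi> * ?q j \<xi>)"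
    by (rule expected_matches_eq_sum) (use P Q k in \<open>simp_all add: gibbs_measure_def\<close>)
  \<comment> \<open>There are \<open>n - k + 1\<close> positions, and the pairs are ordered with
    distinct entries.\<close>
  have count: "(\<Sum>i\<in>{0..n - k}. \<Sum>j\<in>{0..n - k} - {i}. t) = real_of_int ((n - k + 1) * (n - k)) * t"
    for t :: real
    using k by (simp add: card_Diff_singleton of_nat_diff algebra_simps)
  show "real_of_int ((n - k + 1) * (n - k)) * (overlap k / c) \<le> expected_matches P Q n k"
    and "expected_matches P Q n k \<le> real_of_int ((n - k + 1) * (n - k)) * (c * overlap k)"
    unfolding eq count[symmetric] by (intro sum_mono lower upper)+
qed

text \<open>Here \<open>n\<^sup>2 exp (- 2 \<alpha> k) = exp (2 \<alpha> (k* - k))\<close> by the choice of \<open>k* = ln n / \<alpha>\<close>.\<close>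

lemma expected_matches_k_star:
  assumes card: "CARD('a) \<ge> 2" and P: "gibbs_measure U P" and Q: "gibbs_measure V Q"
  obtains C where "C > 0"
    "\<And>n k. 1 \<le> k \<Longrightarrow> k < int n \<Longrightarrow>
      expected_matches P Q (int n) k \<le> C * exp (2 * alpha_tilde U V * (k_star_tilde U V n - real_of_int k))"
    "\<And>n k. 1 \<le> k \<Longrightarrow> 2 * k \<le> int n \<Longrightarrow>
      exp (2 * alpha_tilde U V * (k_star_tilde U V n - real_of_int k)) / (4 * C)
        \<le> expected_matches P Q (int n) k"
proof -
  let ?\<alpha> = "alpha_tilde U V"
  define K where "K = U.strength + V.strength + W.strength"
  define c where "c = exp (4 * U.strength + 4 * V.strength)"
  have \<alpha>: "?\<alpha> > 0"
    using alpha_tilde_pos[OF card] .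
  have star: "exp (2 * ?\<alpha> * (k_star_tilde U V n - real_of_int k)) =
      (real n)\<^sup>2 * exp (- 2 * ?\<alpha> * real_of_int k)" if "n > 0" for n k
  proof -
    have "2 * ?\<alpha> * (k_star_tilde U V n - real_of_int k) =
        ln (real n) + ln (real n) + - 2 * ?\<alpha> * real_of_int k"
      using \<alpha> by (simp add: k_star_tilde_def field_simps)
    then have "exp (2 * ?\<alpha> * (k_star_tilde U V n - real_of_int k)) =
        exp (ln (real n)) * exp (ln (real n)) * exp (- 2 * ?\<alpha> * real_of_int k)"
      by (simp only: exp_add)
    then show ?thesis
      using that by (simp add: power2_eq_square)
  qed
  have c: "c > 0"
    by (simp add: c_def)
  show thesis
  \<comment> \<open>The factor \<open>c\<close> accounts for the Gibbs comparison and
    \<open>exp K\<close> for the pressures.\<close>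
  proof (rule that[of "c * exp K"])
    show "c * exp K > 0"
      using c by simp
    fix n :: nat and k :: int assume k: "1 \<le> k"
    let ?E = "exp (- 2 * ?\<alpha> * real_of_int k)"
    have ov: "exp (- K) * ?E \<le> overlap k" "overlap k \<le> exp K * ?E"
      using overlap_bounds[OF k] unfolding K_def by auto
    {
      assume kn: "k < int n"
      have "(int n - k + 1) * (int n - k) \<le> int n * int n"
        using k kn by (intro mult_mono) auto
      then have "real_of_int ((int n - k + 1) * (int n - k)) \<le> real_of_int (int n * int n)"
        by (simp only: of_int_le_iff)
      then have le: "real_of_int ((int n - k + 1) * (int n - k)) \<le> (real n)\<^sup>2"
        by (simp add: power2_eq_square)
      have "expected_matches P Q (int n) k \<le> real_of_int ((int n - k + 1) * (int n - k)) * (c * overlap k)"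
        using expected_matches_bounds(2)[OF P Q k kn] unfolding c_def .
      also have "\<dots> \<le> (real n)\<^sup>2 * (c * (exp K * ?E))"
        using le ov c k kn by (intro mult_mono mult_left_mono) (auto simp: overlap_def partition_fun_pos less_imp_le)
      also have "\<dots> = c * exp K * exp (2 * ?\<alpha> * (k_star_tilde U V n - real_of_int k))"
        using k kn by (subst star) auto
      finally show "expected_matches P Q (int n) k \<le>
          c * exp K * exp (2 * ?\<alpha> * (k_star_tilde U V n - real_of_int k))" .
    next
      assume kn: "2 * k \<le> int n"
      then have kn': "k < int n"
        using k by linarith
      \<comment> \<open>For \<open>2 * k \<le> n\<close> both factors of the pair count are at least
        half of \<open>n\<close>; this is the source of the 4 in the lower bound.\<close>
      have n: "0 \<le> real n / 2" "real n / 2 \<le> real_of_int (int n - k)"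
        "real n / 2 \<le> real_of_int (int n - k + 1)"
        using kn by linarith+
      have le: "(real n)\<^sup>2 / 4 \<le> real_of_int ((int n - k + 1) * (int n - k))"
        using mult_mono'[OF n(3,2,1,1)] by (simp add: power2_eq_square)
      have "exp (2 * ?\<alpha> * (k_star_tilde U V n - real_of_int k)) / (4 * (c * exp K)) =
          (real n)\<^sup>2 / 4 * (exp (- K) * ?E / c)"
        using k kn by (subst star) (auto simp: exp_minus field_simps)
      also have "\<dots> \<le> real_of_int ((int n - k + 1) * (int n - k)) * (overlap k / c)"
        using kn' c by (intro mult_mono le divide_right_mono ov) auto
      also have "\<dots> \<le> expected_matches P Q (int n) k"
        using expected_matches_bounds(1)[OF P Q k kn'] unfolding c_def .
      finally show "exp (2 * ?\<alpha> * (k_star_tilde U V n - real_of_int k)) / (4 * (c * exp K)) \<le>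
          expected_matches P Q (int n) k" .
    }
  qed
qed

end

section \<open>The three regimes of word length\<close>

text \<open>As \<open>k_star_tilde\<close> grows logarithmically, words of at most this length plus
  a constant eventually fill no more than half of the string, as the lower bound on the number of
  matches requires.\<close>

lemma k_star_tilde_sublinear:
  assumes upper: "\<forall>\<^sub>F n in sequentially. real_of_int (k n) \<le> k_star_tilde U V n + B"
  shows "\<forall>\<^sub>F n in sequentially. 2 * k n \<le> int n"
proof -
  have "(\<lambda>n. ln (real n) / real n / alpha_tilde U V + B / real n) \<longlonglongrightarrow> 0 / alpha_tilde U V + 0"
    unfolding divide_inverse[of _ "alpha_tilde U V"]
    by (intro tendsto_intros lim_ln_over_n lim_const_over_n)
  then have "\<forall>\<^sub>F n in sequentially. ln (real n) / real n / alpha_tilde U V + B / real n < 1 / 2"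
    by (rule order_tendstoD) simp
  with upper eventually_gt_at_top[of 0] show ?thesis
  proof eventually_elim
    case (elim n)
    have "(k_star_tilde U V n + B) / real n = ln (real n) / real n / alpha_tilde U V + B / real n"
      by (simp add: k_star_tilde_def add_divide_distrib)
    with elim have "k_star_tilde U V n + B < real n / 2"
      by (simp add: field_simps)
    with elim have "2 * real_of_int (k n) \<le> real n"
      by linarith
    then show ?case by linarith
  qed
qed

theorem theorem5p4:
  fixes U V :: "'a::finite interaction"
    and P Q :: "'a config measure"
    and k :: "nat \<Rightarrow> int"
  assumes "CARD('a) \<ge> 2"
    and "U \<in> interactions" and "V \<in> interactions"
    and "gibbs_measure U P" and "gibbs_measure V Q"
    and "\<forall>\<^sub>F n in sequentially. 1 \<le> k n \<and> k n < int n"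
  shows "alpha_tilde U V > 0 \<and>
    (filterlim (\<lambda>n. k_star_tilde U V n - real_of_int (k n)) at_top sequentially \<longrightarrow>
       filterlim (\<lambda>n. expected_matches P Q (int n) (k n)) at_top sequentially) \<and>
    (filterlim (\<lambda>n. real_of_int (k n) - k_star_tilde U V n) at_top sequentially \<longrightarrow>
       (\<lambda>n. expected_matches P Q (int n) (k n)) \<longlonglongrightarrow> 0) \<and>
    (Bseq (\<lambda>n. real_of_int (k n) - k_star_tilde U V n) \<longrightarrow>
       0 < liminf (\<lambda>n. ereal (expected_matches P Q (int n) (k n))) \<and>
       liminf (\<lambda>n. ereal (expected_matches P Q (int n) (k n)))
         \<le> limsup (\<lambda>n. ereal (expected_matches P Q (int n) (k n))) \<and>
       limsup (\<lambda>n. ereal (expected_matches P Q (int n) (k n))) < \<infinity>)"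
proof -
  interpret interaction_pair U V "\<lambda>A. SUP \<sigma>. \<bar>U A \<sigma>\<bar>" "\<lambda>A. SUP \<sigma>. \<bar>V A \<sigma>\<bar>"
    unfolding interaction_pair_def using assms(2,3) by (simp add: interactions_local_interaction)
  let ?\<alpha> = "alpha_tilde U V"
  let ?E = "\<lambda>n. expected_matches P Q (int n) (k n)"
  let ?d = "\<lambda>n. k_star_tilde U V n - real_of_int (k n)"
  have \<alpha>: "?\<alpha> > 0"
    using alpha_tilde_pos[OF assms(1)] .
  obtain C where C: "C > 0"
    and C_upper: "\<And>n k. 1 \<le> k \<Longrightarrow> k < int n \<Longrightarrow>
      expected_matches P Q (int n) k \<le> C * exp (2 * ?\<alpha> * (k_star_tilde U V n - real_of_int k))"
    and C_lower: "\<And>n k. 1 \<le> k \<Longrightarrow> 2 * k \<le> int n \<Longrightarrow>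
      exp (2 * ?\<alpha> * (k_star_tilde U V n - real_of_int k)) / (4 * C) \<le> expected_matches P Q (int n) k"
    using expected_matches_k_star[OF assms(1,4,5)] by blast
  \<comment> \<open>All three claims follow from comparing \<open>?E n\<close> with
    \<open>exp (2 * ?\<alpha> * ?d n)\<close>; the upper comparison holds for every admissible
    \<open>k\<close>, the lower one when \<open>k\<close> exceeds \<open>k_star_tilde\<close> by at
    most a constant.\<close>
  have upper: "\<forall>\<^sub>F n in sequentially. ?E n \<le> C * exp (2 * ?\<alpha> * ?d n)"
    using assms(6) by eventually_elim (simp add: C_upper)
  have lower: "\<forall>\<^sub>F n in sequentially. exp (2 * ?\<alpha> * ?d n) / (4 * C) \<le> ?E n"
    if "\<forall>\<^sub>F n in sequentially. real_of_int (k n) \<le> k_star_tilde U V n + B" for B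
    using k_star_tilde_sublinear[OF that] assms(6) by eventually_elim (simp add: C_lower)
  have nonneg: "0 \<le> ?E n" for n
    unfolding expected_matches_def by (rule integral_nonneg_AE) auto
  have part1: "filterlim ?E at_top sequentially" if "filterlim ?d at_top sequentially"
  proof -
    \<comment> \<open>Eventually \<open>k n\<close> is below \<open>k_star_tilde U V n\<close>, so
      the lower comparison applies with the constant 0.\<close>
    have "\<forall>\<^sub>F n in sequentially. 0 \<le> ?d n"
      using that unfolding filterlim_at_top by blast
    then have "\<forall>\<^sub>F n in sequentially. real_of_int (k n) \<le> k_star_tilde U V n + 0"
      by eventually_elim simp
    from lower[OF this] show ?thesis
    proof (rule filterlim_at_top_mono[rotated])
      have "filterlim (\<lambda>n. 2 * ?\<alpha> * ?d n) at_top sequentially"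
        using \<alpha> by (intro filterlim_tendsto_pos_mult_at_top[OF tendsto_const _ that]) simp
      then have "filterlim (\<lambda>n. exp (2 * ?\<alpha> * ?d n)) at_top sequentially"
        by (rule filterlim_compose[OF exp_at_top])
      then have "filterlim (\<lambda>n. 1 / (4 * C) * exp (2 * ?\<alpha> * ?d n)) at_top sequentially"
        using C by (intro filterlim_tendsto_pos_mult_at_top[OF tendsto_const]) simp_all
      then show "filterlim (\<lambda>n. exp (2 * ?\<alpha> * ?d n) / (4 * C)) at_top sequentially"
        by simp
    qed
  qed
  have part2: "?E \<longlonglongrightarrow> 0" if "filterlim (\<lambda>n. real_of_int (k n) - k_star_tilde U V n) at_top sequentially"
  proof (rule tendsto_sandwich[OF _ upper tendsto_const])
    have "filterlim (\<lambda>n. 2 * ?\<alpha> * (real_of_int (k n) - k_star_tilde U V n)) at_top sequentially"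
      using \<alpha> by (intro filterlim_tendsto_pos_mult_at_top[OF tendsto_const _ that]) simp
    then have "filterlim (\<lambda>n. 2 * ?\<alpha> * ?d n) at_bot sequentially"
      by (subst filterlim_uminus_at_bot) (simp add: algebra_simps)
    then have "(\<lambda>n. exp (2 * ?\<alpha> * ?d n)) \<longlonglongrightarrow> 0"
      by (rule filterlim_compose[OF exp_at_bot])
    then show "(\<lambda>n. C * exp (2 * ?\<alpha> * ?d n)) \<longlonglongrightarrow> 0"
      by (rule tendsto_mult_right_zero)
  qed (simp add: nonneg)
  have part3: "0 < liminf (\<lambda>n. ereal (?E n)) \<and> liminf (\<lambda>n. ereal (?E n)) \<le> limsup (\<lambda>n. ereal (?E n)) \<and>
      limsup (\<lambda>n. ereal (?E n)) < \<infinity>" if bounded: "Bseq (\<lambda>n. real_of_int (k n) - k_star_tilde U V n)"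
  proof (intro conjI)
    obtain B where B: "\<And>n. \<bar>real_of_int (k n) - k_star_tilde U V n\<bar> \<le> B"
      using bounded unfolding Bseq_def by auto
    \<comment> \<open>With \<open>?d\<close> confined to a bounded interval, the exponential lies
      between two positive constants, which bound the lower and upper limits.\<close>
    have d: "- B \<le> ?d n" "?d n \<le> B" for n
      using B[of n] by linarith+
    have "\<forall>\<^sub>F n in sequentially. real_of_int (k n) \<le> k_star_tilde U V n + B"
      using d(1) by (simp add: algebra_simps)
    from lower[OF this]
    have "\<forall>\<^sub>F n in sequentially. ereal (exp (2 * ?\<alpha> * (- B)) / (4 * C)) \<le> ereal (?E n)"
    proof eventually_elim
      case (elim n)
      have "exp (2 * ?\<alpha> * (- B)) / (4 * C) \<le> exp (2 * ?\<alpha> * ?d n) / (4 * C)"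
        using d(1)[of n] \<alpha> C
        by (intro divide_right_mono iffD2[OF exp_le_cancel_iff] mult_left_mono) simp_all
      with elim show ?case by simp
    qed
    from Liminf_bounded[OF this]
    show "0 < liminf (\<lambda>n. ereal (?E n))"
      using C by (intro less_le_trans[OF _ \<open>_ \<le> liminf _\<close>]) simp
    show "liminf (\<lambda>n. ereal (?E n)) \<le> limsup (\<lambda>n. ereal (?E n))"
      by (rule Liminf_le_Limsup) simp
    from upper have "\<forall>\<^sub>F n in sequentially. ereal (?E n) \<le> ereal (C * exp (2 * ?\<alpha> * B))"
    proof eventually_elim
      case (elim n)
      have "C * exp (2 * ?\<alpha> * ?d n) \<le> C * exp (2 * ?\<alpha> * B)"
        using d(2)[of n] \<alpha> C by (intro mult_left_mono) auto
      with elim show ?case by simp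
    qed
    from Limsup_bounded[OF this] show "limsup (\<lambda>n. ereal (?E n)) < \<infinity>"
      by (rule le_less_trans) simp
  qed
  show ?thesis
    using \<alpha> part1 part2 part3 by blast
qed

end
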